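(* Let $G$ be a connected simple infinite graph. Let $\tau'$ be the topology on the set $\beta G$ obtained from the topology of the Stone–Čech compactification $\beta G$ by declaring $G$ to be open, and let $(\beta G,\tau')/{\approx_\ast}$ be the quotient space of $(\beta G,\tau')$ obtained by collapsing each connected component of the Stone–Čech remainder $G^\ast=\beta G\setminus G$ to a single point. Then the tangle compactification $|G|_\Theta$ of $G$ is homeomorphic to $(\beta G,\tau')/{\approx_\ast}$.
   Context: 1-complex: $G=(V,E)$ also denotes its 1-complex, in which every edge $e=xy$ is a copy $[x,y]=\{x\}\sqcup\mathring e\sqcup\{y\}$ of $[0,1]$ with $\mathring e$ (the inner edge points) corresponding to $(0,1)$; the point set is $V\sqcup\bigsqcup_{e\in E}\mathring e$, inner edge points have their usual basic open neighbourhoods inside $\mathring e$, and a neighbourhood basis of a vertex $v$ consists of all unions $\bigcup_{e\in E(v)}[v,i_e)$ with $i_e\in\mathring e$ arbitrary, $E(v)$ being the set of edges incident with $v$. $\beta G$ is the Stone–Čech compactification of the 1-complex $G$, and $G^\ast=\beta G\setminus G$ with the subspace topology from $\beta G$. "Connected components of $G^\ast$" refers to this subspace topology; $\approx_\ast$ is the equivalence relation whose classes on $G^\ast$ are these components (and which is trivial on $G$). "Declaring $G$ to be open" means that $\tau'$ is the topology generated by the open sets of $\beta G$ together with the set $G$. Tangles: $\mathcal X$ is the set of finite subsets of $V$, directed by inclusion. For $X\in\mathcal X$, $\mathcal C_X$ is the set of (graph) components of $G-X$ with the discrete topology; for $X\subseteq X'$ the map $\mathfrak c_{X',X}\colon\mathcal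 C_{X'}\to\mathcal C_X$ sends each component of $G-X'$ to the component of $G-X$ including it, and $\beta(\mathfrak c_{X',X})\colon\beta(\mathcal C_{X'})\to\beta(\mathcal C_X)$ is its continuous extension. The tangle space of $G$ is the compact Hausdorff space $\Theta=\varprojlim_{X\in\mathcal X}\beta(\mathcal C_X)$; its elements are called $\aleph_0$-tangles. An $\aleph_0$-tangle $\tau$ is thus a compatible family $(U(\tau,X)\mid X\in\mathcal X)$ of ultrafilters $U(\tau,X)$ on $\mathcal C_X$. Tangle compactification: $|G|_\Theta$ is the set $G\sqcup\Theta$ with the topology generated by the open sets of the 1-complex $G$ together with, for all $X\in\mathcal X$ and $\mathcal C\subseteq\mathcal C_X$, the sets $$\mathcal O_{|G|_\Theta}(X,\mathcal C)=\bigcup\mathcal C\ \cup\ \mathring E(X,\textstyle\bigcup\mathcal C)\ \cup\ \{\tau\in\Theta\mid\mathcal C\in U(\tau,X)\},$$ where $\bigcup\mathcal C$ is the union of (the 1-complexes of) the components in $\mathcal C$ and $\mathring E(X,\bigcup\mathcal C)$ is the set of inner points of all edges of $G$ between $X$ and vertices of components in $\mathcal C$. *)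

theory Defs
  imports "HOL-Analysis.Analysis"
begin

section \<open>Graphs\<close>

text \<open>A simple graph is given by its vertex set \<open>V\<close> and its set \<open>E\<close> of two-element edges.\<close>

definition simple_graph :: "'a set \<Rightarrow> 'a set set \<Rightarrow> bool" where
  "simple_graph V E \<longleftrightarrow> (\<forall>e\<in>E. e \<subseteq> V \<and> card e = 2)"

definition joined_within :: "'a set set \<Rightarrow> 'a set \<Rightarrow> ('a \<times> 'a) set" where
  "joined_within E W = {(u, v). u \<in> W \<and> v \<in> W \<and> {u, v} \<in> E}\<^sup>*"

definition connected_graph :: "'a set \<Rightarrow> 'a set set \<Rightarrow> bool" where
  "connected_graph V E \<longleftrightarrow> V \<noteq> {} \<and> (\<forall>u\<in>V. \<forall>v\<in>V. (u, v) \<in> joined_within E V)"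

text \<open>
  The components of \<open>G - X\<close>, for \<open>X \<subseteq> V\<close>. They are induced subgraphs, so a component is
  represented by its vertex set.
\<close>

definition comps :: "'a set \<Rightarrow> 'a set set \<Rightarrow> 'a set \<Rightarrow> 'a set set" where
  "comps V E X = {joined_within E (V - X) `` {u} | u. u \<in> V - X}"


section \<open>The 1-complex of a graph\<close>

text \<open>
  Points are encoded by barycentric coordinates: the edge \<open>xy\<close> is the copy
  \<open>{edge_point x y t | 0 \<le> t \<le> 1}\<close> of the unit interval, running from \<open>x\<close> to \<open>y\<close>. This needs no
  choice of orientations, because \<open>edge_point x y t = edge_point y x (1 - t)\<close>.
\<close>

definition vertex_point :: "'a \<Rightarrow> 'a \<Rightarrow> real" where
  "vertex_point v = (\<lambda>z. if z = v then 1 else 0)"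

definition edge_point :: "'a \<Rightarrow> 'a \<Rightarrow> real \<Rightarrow> 'a \<Rightarrow> real" where
  "edge_point x y t = (\<lambda>z. (1 - t) * vertex_point x z + t * vertex_point y z)"

definition inner_points :: "'a set set \<Rightarrow> ('a \<Rightarrow> real) set" where
  "inner_points F = {edge_point x y t | x y t. {x, y} \<in> F \<and> 0 < t \<and> t < 1}"

definition complex_points :: "'a set \<Rightarrow> 'a set set \<Rightarrow> ('a \<Rightarrow> real) set" where
  "complex_points V E = vertex_point ` V \<union> inner_points E"

text \<open>
  The union of the half-open segments from \<open>v\<close> of length \<open>r w\<close> on the edges \<open>vw\<close>. The lengths
  need not be bounded below, so this is not the metric topology at a vertex of infinite degree.
\<close>

definition open_star :: "'a set set \<Rightarrow> 'a \<Rightarrow> ('a \<Rightarrow> real) \<Rightarrow> ('a \<Rightarrow> real) set" where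
  "open_star E v r = insert (vertex_point v) (\<Union>w\<in>{w. {v, w} \<in> E}. edge_point v w ` {0..<r w})"

definition one_complex :: "'a set \<Rightarrow> 'a set set \<Rightarrow> ('a \<Rightarrow> real) topology" where
  "one_complex V E = topology_generated_by
    ({edge_point x y ` {a<..<b} | x y a b. {x, y} \<in> E \<and> 0 \<le> a \<and> b \<le> 1} \<union>
     {open_star E v r | v r. v \<in> V \<and> (\<forall>w. {v, w} \<in> E \<longrightarrow> 0 < r w \<and> r w < 1)})"


section \<open>The Stone-Cech compactification\<close>

text \<open>
  The closure of the image of \<open>X\<close> under the evaluation map into the cube indexed by all continuous
  functions from \<open>X\<close> to the unit interval. These are taken extensional on \<open>topspace X\<close>, so that
  each of them occurs once as an index. The space \<open>X\<close> is identified with its image under \<open>sc_embed\<close>,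
  which is an embedding for completely regular Hausdorff \<open>X\<close>.
\<close>

definition unit_functions :: "'a topology \<Rightarrow> ('a \<Rightarrow> real) set" where
  "unit_functions X =
    {f. continuous_map X (top_of_set {0..1}) f \<and> f \<in> extensional (topspace X)}"

definition sc_embed :: "'a topology \<Rightarrow> 'a \<Rightarrow> ('a \<Rightarrow> real) \<Rightarrow> real" where
  "sc_embed X x = (\<lambda>f\<in>unit_functions X. f x)"

definition stone_cech :: "'a topology \<Rightarrow> (('a \<Rightarrow> real) \<Rightarrow> real) topology" where
  "stone_cech X =
    (let Q = product_topology (\<lambda>_. top_of_set {0..1}) (unit_functions X)
     in subtopology Q (Q closure_of (sc_embed X ` topspace X)))"

definition stone_cech_remainder :: "'a topology \<Rightarrow> (('a \<Rightarrow> real) \<Rightarrow> real) set" where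
  "stone_cech_remainder X = topspace (stone_cech X) - sc_embed X ` topspace X"

definition stone_cech_base_open :: "'a topology \<Rightarrow> (('a \<Rightarrow> real) \<Rightarrow> real) topology" where
  "stone_cech_base_open X = topology_generated_by
    ({U. openin (stone_cech X) U} \<union> {sc_embed X ` topspace X})"

text \<open>Two points of the remainder are equivalent iff they lie in the same component of it.\<close>

definition remainder_equiv ::
    "'a topology \<Rightarrow> ((('a \<Rightarrow> real) \<Rightarrow> real) \<times> (('a \<Rightarrow> real) \<Rightarrow> real)) set" where
  "remainder_equiv X = {(p, q). p \<in> topspace (stone_cech X) \<and> q \<in> topspace (stone_cech X) \<and>
    (p = q \<or>
     connected_component_of (subtopology (stone_cech X) (stone_cech_remainder X)) p q)}"


section \<open>Quotient spaces\<close>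

definition quotient_space :: "'a topology \<Rightarrow> ('a \<times> 'a) set \<Rightarrow> 'a set topology" where
  "quotient_space X R = topology (\<lambda>\<U>. \<U> \<subseteq> topspace X // R \<and>
     openin X {x \<in> topspace X. R `` {x} \<in> \<U>})"

lemma openin_quotient_space:
  "openin (quotient_space X R) \<U> \<longleftrightarrow>
    \<U> \<subseteq> topspace X // R \<and> openin X {x \<in> topspace X. R `` {x} \<in> \<U>}"
proof -
  have "istopology (\<lambda>\<U>. \<U> \<subseteq> topspace X // R \<and> openin X {x \<in> topspace X. R `` {x} \<in> \<U>})"
    unfolding istopology_def
  proof (intro conjI allI impI)
    fix S T
    assume S: "S \<subseteq> topspace X // R \<and> openin X {x \<in> topspace X. R `` {x} \<in> S}"
      and T: "T \<subseteq> topspace X // R \<and> openin X {x \<in> topspace X. R `` {x} \<in> T}"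
    show "S \<inter> T \<subseteq> topspace X // R" using S by blast
    have "{x \<in> topspace X. R `` {x} \<in> S \<inter> T} =
      {x \<in> topspace X. R `` {x} \<in> S} \<inter> {x \<in> topspace X. R `` {x} \<in> T}" by blast
    then show "openin X {x \<in> topspace X. R `` {x} \<in> S \<inter> T}" using S T by auto
  next
    fix \<K>
    assume K: "\<forall>K\<in>\<K>. K \<subseteq> topspace X // R \<and> openin X {x \<in> topspace X. R `` {x} \<in> K}"
    show "\<Union>\<K> \<subseteq> topspace X // R" using K by blast
    have "{x \<in> topspace X. R `` {x} \<in> \<Union>\<K>} = (\<Union>K\<in>\<K>. {x \<in> topspace X. R `` {x} \<in> K})"
      by blast
    then show "openin X {x \<in> topspace X. R `` {x} \<in> \<Union>\<K>}" using K by auto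
  qed
  then show ?thesis
    unfolding quotient_space_def by (simp add: topology_inverse')
qed

lemma topspace_quotient_space [simp]: "topspace (quotient_space X R) = topspace X // R"
proof -
  have "{x \<in> topspace X. R `` {x} \<in> topspace X // R} = topspace X"
    by (auto simp: quotient_def)
  then have "openin (quotient_space X R) (topspace X // R)"
    by (simp add: openin_quotient_space)
  then show ?thesis
    by (metis openin_quotient_space openin_subset openin_topspace subset_antisym)
qed

lemma quotient_map_quotient_space: "quotient_map X (quotient_space X R) (\<lambda>x. R `` {x})"
  by (auto simp: quotient_map_def openin_quotient_space quotient_def)


section \<open>Tangles and the tangle compactification\<close>

definition ultrafilters_on :: "'b set \<Rightarrow> 'b set set set" where
  "ultrafilters_on S = {\<U>. \<U> \<subseteq> Pow S \<and> S \<in> \<U> \<and> {} \<notin> \<U> \<and>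
     (\<forall>A\<in>\<U>. \<forall>B\<in>\<U>. A \<inter> B \<in> \<U>) \<and>
     (\<forall>A\<in>\<U>. \<forall>B. A \<subseteq> B \<and> B \<subseteq> S \<longrightarrow> B \<in> \<U>) \<and>
     (\<forall>A. A \<subseteq> S \<longrightarrow> A \<in> \<U> \<or> S - A \<in> \<U>)}"

text \<open>
  The points of the Stone-Cech compactification of a discrete space are the ultrafilters on it,
  and the continuous extension of a map between discrete spaces takes image ultrafilters.
\<close>

definition ultrafilter_image ::
    "('b \<Rightarrow> 'c) \<Rightarrow> 'b set \<Rightarrow> 'c set \<Rightarrow> 'b set set \<Rightarrow> 'c set set" where
  "ultrafilter_image f S T \<U> = {A. A \<subseteq> T \<and> {x \<in> S. f x \<in> A} \<in> \<U>}"

definition comp_map :: "'a set \<Rightarrow> 'a set set \<Rightarrow> 'a set \<Rightarrow> 'a set \<Rightarrow> 'a set" where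
  "comp_map V E X C' = (THE C. C \<in> comps V E X \<and> C' \<subseteq> C)"

definition tangles :: "'a set \<Rightarrow> 'a set set \<Rightarrow> ('a set \<Rightarrow> 'a set set set) set" where
  "tangles V E =
    {\<tau> \<in> (\<Pi>\<^sub>E X\<in>{X. finite X \<and> X \<subseteq> V}. ultrafilters_on (comps V E X)).
      \<forall>X X'. finite X' \<and> X' \<subseteq> V \<and> X \<subseteq> X' \<longrightarrow>
        \<tau> X = ultrafilter_image (comp_map V E X) (comps V E X') (comps V E X) (\<tau> X')}"

definition tangle_nbhd ::
    "'a set \<Rightarrow> 'a set set \<Rightarrow> 'a set \<Rightarrow> 'a set set \<Rightarrow>
      (('a \<Rightarrow> real) + ('a set \<Rightarrow> 'a set set set)) set" where
  "tangle_nbhd V E X \<C> =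
     Inl ` ((\<Union>C\<in>\<C>. complex_points C {e\<in>E. e \<subseteq> C}) \<union>
            inner_points {e\<in>E. \<exists>x\<in>X. \<exists>y\<in>\<Union>\<C>. e = {x, y}}) \<union>
     Inr ` {\<tau> \<in> tangles V E. \<C> \<in> \<tau> X}"

definition tangle_compactification ::
    "'a set \<Rightarrow> 'a set set \<Rightarrow> (('a \<Rightarrow> real) + ('a set \<Rightarrow> 'a set set set)) topology" where
  "tangle_compactification V E = topology_generated_by
    ({Inl ` U | U. openin (one_complex V E) U} \<union>
     {tangle_nbhd V E X \<C> | X \<C>. finite X \<and> X \<subseteq> V \<and> \<C> \<subseteq> comps V E X})"

end

theory Submission
  imports Defs
begin

text \<open>
  Write \<open>G\<close> for the 1-complex, \<open>\<beta>G\<close> for its Stone-Cech compactification and \<open>cl\<close> for closures in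
  \<open>\<beta>G\<close>. The idea is to write down the collapsing map directly: it fixes \<open>G\<close> and sends a point \<open>p\<close> of
  the remainder to a tangle. For a set \<open>W\<close> of vertices let \<open>open_hull W\<close> consist of all points of
  \<open>G\<close> with a barycentric coordinate in \<open>W\<close> that is not zero. If \<open>\<C>\<close> is a set of components of
  \<open>G - X\<close>, then \<open>open_hull (\<Union>\<C>)\<close> is the trace on \<open>G\<close> of the basic open set of the tangle
  compactification given by \<open>X\<close> and \<open>\<C>\<close>. The tangle of \<open>p\<close> contains \<open>\<C>\<close> at \<open>X\<close> iff \<open>p\<close> lies in
  \<open>cl (open_hull (\<Union>\<C>))\<close>. These \<open>\<C>\<close> form an ultrafilter because the hulls of complementary sets of
  components are separated by the compact complex \<open>G[X]\<close>: a continuous function vanishing on \<open>G[X]\<close>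
  stays continuous when it is set to zero outside one of the two hulls, and extending the result to
  \<open>\<beta>G\<close> shows that the two closures have no common point in the remainder
  (\<open>cl_disjoint_on_remainder\<close>). It remains to see that the map is a quotient map for the topology in
  which \<open>G\<close> is declared open, and that its fibres in the remainder are the components.

  A set of points in \<open>G\<close> with at most one point of each support is closed in \<open>G\<close>, and so are all its
  subsets. The intersections of such a set with the hulls belonging to a tangle \<open>\<tau>\<close> therefore have
  no common limit in \<open>G\<close>, and compactness of \<open>\<beta>G\<close> produces a limit in the remainder, whose tangle
  must be \<open>\<tau>\<close> (\<open>limit_of_discrete_set\<close>). This gives surjectivity, and it also gives
  the quotient property: an open set \<open>U\<close> of \<open>\<beta>G\<close> that contains the fibre over \<open>\<tau>\<close> contains a whole hull
  belonging to \<open>\<tau>\<close>, and it meets all fibres over some neighbourhood of \<open>\<tau>\<close>. The detour through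
  discrete sets is needed because the fibre over \<open>\<tau>\<close> is in general not compact: its closure in \<open>\<beta>G\<close> may
  contain vertices of \<open>G\<close>.

  A fibre contains every component that it meets, since membership of \<open>\<C>\<close> in the tangle of \<open>p\<close> is a clopen
  condition on the remainder. Conversely, let \<open>p\<close> and \<open>q\<close> have the same tangle \<open>\<tau>\<close>. Around every vertex
  there is an open star whose closure in \<open>\<beta>G\<close> avoids both points. Cutting from each hull
  \<open>open_hull W\<close> the stars around the vertices outside \<open>W\<close> leaves a closed subset of \<open>G\<close>, and the
  intersection of the closures of these sets over all \<open>W\<close> belonging to \<open>\<tau>\<close> still contains \<open>p\<close> and
  \<open>q\<close> but contains no point of \<open>G\<close>. It is connected: the trimmed hull of a single component is
  connected, so a separation would divide some \<open>\<C>\<close> in \<open>\<tau>\<close> into two parts, and the ultrafilter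
  contains one of them (\<open>tangle_at_eq_imp_connected\<close>).
\<close>

section \<open>The Stone-Cech compactification of a Tychonoff space\<close>

text \<open>
  This form of compactness is used twice: with \<open>U\<close> empty it yields limit points, and with \<open>U\<close> a union
  of two disjoint open sets it shows that an intersection of closed sets is connected.
\<close>

lemma compact_space_directed_closed:
  assumes "compact_space X" and "\<K> \<noteq> {}"
    and closed: "\<And>K. K \<in> \<K> \<Longrightarrow> closedin X K"
    and directed: "\<And>K L. K \<in> \<K> \<Longrightarrow> L \<in> \<K> \<Longrightarrow> \<exists>M\<in>\<K>. M \<subseteq> K \<inter> L"
    and "openin X U" and sub: "\<Inter>\<K> \<subseteq> U"
  shows "\<exists>K\<in>\<K>. K \<subseteq> U"
proof -
  have lower: "\<exists>M\<in>\<K>. M \<subseteq> \<Inter>\<F>" if "finite \<F>" "\<F> \<subseteq> \<K>" for \<F>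
    using that
  proof (induction \<F>)
    case empty
    then show ?case using \<open>\<K> \<noteq> {}\<close> by auto
  next
    case (insert K \<F>)
    have "K \<in> \<K>" and "\<F> \<subseteq> \<K>" using insert.prems by auto
    then obtain M where M: "M \<in> \<K>" "M \<subseteq> \<Inter>\<F>" using insert.IH by blast
    then obtain N where N: "N \<in> \<K>" "N \<subseteq> K \<inter> M" using directed \<open>K \<in> \<K>\<close> by blast
    then have "N \<subseteq> \<Inter>(insert K \<F>)" using M(2) by blast
    then show ?case using N(1) by blast
  qed
  show ?thesis
  proof (rule ccontr)
    assume none: "\<not> ?thesis"
    have cU: "closedin X (topspace X - U)"
      using \<open>openin X U\<close> by blast
    have "(topspace X - U) \<inter> \<Inter>\<F> \<noteq> {}" if \<F>: "finite \<F>" "\<F> \<subseteq> \<K>" for \<F>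
    proof -
      obtain M where M: "M \<in> \<K>" "M \<subseteq> \<Inter>\<F>" using lower[OF \<F>] by auto
      then show ?thesis using none closedin_subset[OF closed[OF M(1)]] by blast
    qed
    then have "(topspace X - U) \<inter> \<Inter>\<K> \<noteq> {}"
      using closedin_compact_space[OF \<open>compact_space X\<close> cU] closed
      by (simp add: compactin_fip)
    then show False using sub by blast
  qed
qed

text \<open>
  Closures of subsets of \<open>X\<close>, taken in the compactification. All later arguments speak about points
  of the remainder through the sets \<open>S\<close> with \<open>p \<in> sc_closure X S\<close>.
\<close>

definition sc_closure :: "'a topology \<Rightarrow> 'a set \<Rightarrow> (('a \<Rightarrow> real) \<Rightarrow> real) set" where
  "sc_closure X S = stone_cech X closure_of (sc_embed X ` S)"

lemma stone_cech_cube: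
  fixes X :: "'a topology"
  defines "Q \<equiv> product_topology (\<lambda>_. top_of_set {0..1}) (unit_functions X)"
  shows stone_cech_eq: "stone_cech X = subtopology Q (Q closure_of (sc_embed X ` topspace X))"
    and sc_embed_in_cube: "sc_embed X ` topspace X \<subseteq> topspace Q"
proof -
  show "stone_cech X = subtopology Q (Q closure_of (sc_embed X ` topspace X))"
    by (simp add: stone_cech_def Q_def Let_def)
  show "sc_embed X ` topspace X \<subseteq> topspace Q"
  proof (rule image_subsetI)
    fix x assume "x \<in> topspace X"
    then have "f x \<in> {0..1}" if "f \<in> unit_functions X" for f
      using that by (auto simp: unit_functions_def continuous_map_in_subtopology)
    then show "sc_embed X x \<in> topspace Q"
      by (simp add: Q_def sc_embed_def PiE_def)
  qed
qed

lemma sc_embed_in_stone_cech: "x \<in> topspace X \<Longrightarrow> sc_embed X x \<in> topspace (stone_cech X)"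
  unfolding stone_cech_eq topspace_subtopology
  using sc_embed_in_cube[of X] closure_of_subset[OF sc_embed_in_cube[of X]] by blast

lemma compact_space_stone_cech: "compact_space (stone_cech X)"
  unfolding stone_cech_eq
  by (intro compact_space_subtopology closedin_compact_space closedin_closure_of)
     (auto simp: compact_space_product_topology compact_space_subtopology)

lemma Hausdorff_space_stone_cech: "Hausdorff_space (stone_cech X)"
  unfolding stone_cech_eq
  by (intro Hausdorff_space_subtopology) (auto simp: Hausdorff_space_product_topology
      Hausdorff_space_subtopology)

lemma continuous_map_sc_embed: "continuous_map X (stone_cech X) (sc_embed X)"
proof -
  have "continuous_map X (product_topology (\<lambda>_. top_of_set {0..1}) (unit_functions X)) (sc_embed X)"
    unfolding continuous_map_componentwise
  proof (intro conjI ballI)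
    show "sc_embed X ` topspace X \<subseteq> extensional (unit_functions X)"
      by (auto simp: sc_embed_def)
    show "continuous_map X (top_of_set {0..1}) (\<lambda>x. sc_embed X x f)" if "f \<in> unit_functions X" for f
      using that by (simp add: sc_embed_def unit_functions_def)
  qed
  then show ?thesis
    unfolding stone_cech_eq
    by (intro continuous_map_into_subtopology)
       (use closure_of_subset[OF sc_embed_in_cube[of X]] in auto)
qed

lemma sc_closure_topspace: "sc_closure X (topspace X) = topspace (stone_cech X)"
proof -
  have "topspace (stone_cech X) \<subseteq> sc_closure X (topspace X)"
    unfolding sc_closure_def stone_cech_eq
    using closure_of_subset[OF sc_embed_in_cube[of X]]
    by (simp add: closure_of_subtopology Int_absorb1)
  then show ?thesis
    using closure_of_subset_topspace sc_closure_def by (metis subset_antisym)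
qed

text \<open>
  A continuous function into the unit interval is, after restriction to \<open>topspace X\<close>, one of the
  indices of the cube, so the projection to that coordinate extends it.
\<close>

lemma stone_cech_extension:
  assumes "continuous_map X (top_of_set {0..1}) g"
  shows "\<exists>g'. continuous_map (stone_cech X) euclideanreal g' \<and>
    (\<forall>x\<in>topspace X. g' (sc_embed X x) = g x)"
proof -
  let ?g = "restrict g (topspace X)"
  have g: "?g \<in> unit_functions X"
    using continuous_map_eq[OF assms, of ?g] by (simp add: unit_functions_def)
  have "continuous_map (stone_cech X) (top_of_set {0..1}) (\<lambda>p. p ?g)"
    unfolding stone_cech_eq
    by (intro continuous_map_from_subtopology continuous_map_product_projection g)
  then have "continuous_map (stone_cech X) euclideanreal (\<lambda>p. p ?g)"
    using continuous_map_in_subtopology by blast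
  moreover have "sc_embed X x ?g = g x" if "x \<in> topspace X" for x
    using g that by (simp add: sc_embed_def)
  ultimately show ?thesis by blast
qed

lemma sc_closure_mono: "S \<subseteq> T \<Longrightarrow> sc_closure X S \<subseteq> sc_closure X T"
  by (simp add: sc_closure_def closure_of_mono image_mono)

lemma sc_closure_Un: "sc_closure X (S \<union> T) = sc_closure X S \<union> sc_closure X T"
  by (simp add: sc_closure_def image_Un closure_of_Un)

lemma sc_closure_empty [simp]: "sc_closure X {} = {}"
  by (simp add: sc_closure_def)

lemma closedin_sc_closure: "closedin (stone_cech X) (sc_closure X S)"
  by (simp add: sc_closure_def)

lemma sc_closure_subset: "sc_closure X S \<subseteq> topspace (stone_cech X)"
  by (simp add: sc_closure_def closure_of_subset_topspace)

lemma subset_sc_closure: "S \<subseteq> topspace X \<Longrightarrow> sc_embed X ` S \<subseteq> sc_closure X S"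
  unfolding sc_closure_def by (intro closure_of_subset) (auto intro: sc_embed_in_stone_cech)

lemma sc_closure_compact:
  assumes "compactin X S"
  shows "sc_closure X S = sc_embed X ` S"
  unfolding sc_closure_def
  by (intro closure_of_closedin compactin_imp_closedin Hausdorff_space_stone_cech
      image_compactin[OF assms] continuous_map_sc_embed)

lemma completely_regular_spaceD:
  fixes X :: "'a topology"
  assumes "completely_regular_space X" and "closedin X S" and "x \<in> topspace X" and "x \<notin> S"
  shows "\<exists>f::'a \<Rightarrow> real. continuous_map X (top_of_set {0..1}) f \<and> f x = 0 \<and> f ` S \<subseteq> {1}"
  using assms unfolding completely_regular_space_def by simp

text \<open>
  With complete regularity the embedding is open onto its image, in the form of a trace:
  the sublevel sets of extended functions that vanish at \<open>x\<close> and are \<open>1\<close> off \<open>U\<close> cut out \<open>U\<close>.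
\<close>

lemma sc_embed_open_trace:
  assumes "completely_regular_space X" and "openin X U"
  shows "\<exists>U'. openin (stone_cech X) U' \<and> (\<forall>x\<in>topspace X. sc_embed X x \<in> U' \<longleftrightarrow> x \<in> U)"
proof -
  let ?U = "\<Union>{T. openin (stone_cech X) T \<and> {x \<in> topspace X. sc_embed X x \<in> T} \<subseteq> U}"
  have mem: "sc_embed X x \<in> ?U" if xU: "x \<in> U" for x
  proof -
    have x: "x \<in> topspace X" using xU openin_subset[OF assms(2)] by auto
    obtain f :: "'a \<Rightarrow> real" where f: "continuous_map X (top_of_set {0..1}) f" "f x = 0"
        "f ` (topspace X - U) \<subseteq> {1}"
      using completely_regular_spaceD[OF assms(1) _ x, of "topspace X - U"] assms(2) xU by blast
    obtain g where g: "continuous_map (stone_cech X) euclideanreal g"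
        "\<And>x. x \<in> topspace X \<Longrightarrow> g (sc_embed X x) = f x"
      using stone_cech_extension[OF f(1)] by blast
    let ?T = "{p \<in> topspace (stone_cech X). g p \<in> {..<1}}"
    have "openin (stone_cech X) ?T"
      by (rule openin_continuous_map_preimage[OF g(1)]) (simp add: open_openin[symmetric])
    moreover have "{x \<in> topspace X. sc_embed X x \<in> ?T} \<subseteq> U"
      using f(3) g(2) by force
    moreover have "sc_embed X x \<in> ?T"
      using x f(2) g(2) sc_embed_in_stone_cech by force
    ultimately show ?thesis by blast
  qed
  show ?thesis
  proof (intro exI[of _ ?U] conjI ballI)
    show "openin (stone_cech X) ?U" by blast
    show "sc_embed X x \<in> ?U \<longleftrightarrow> x \<in> U" if "x \<in> topspace X" for x
      using mem[of x] that by auto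
  qed
qed

lemma sc_closure_trace:
  assumes "completely_regular_space X" and "closedin X S" and "x \<in> topspace X"
    and "sc_embed X x \<in> sc_closure X S"
  shows "x \<in> S"
proof -
  obtain U where U: "openin (stone_cech X) U"
    "\<And>y. y \<in> topspace X \<Longrightarrow> sc_embed X y \<in> U \<longleftrightarrow> y \<in> topspace X - S"
    using sc_embed_open_trace[OF assms(1), of "topspace X - S"] assms(2) by blast
  show ?thesis
  proof (rule ccontr)
    assume "x \<notin> S"
    then have "sc_embed X x \<in> U" using U assms(3) by auto
    then obtain y where "y \<in> S" "sc_embed X y \<in> U"
      using assms(4) U(1) unfolding sc_closure_def in_closure_of by blast
    then show False using U(2) closedin_subset[OF assms(2)] by blast
  qed
qed

lemma inj_on_sc_embed:
  assumes "completely_regular_space X" and "t1_space X"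
  shows "inj_on (sc_embed X) (topspace X)"
proof (rule inj_onI)
  fix x y assume x: "x \<in> topspace X" and y: "y \<in> topspace X" and eq: "sc_embed X x = sc_embed X y"
  have "closedin X {y}" using assms(2) y by (simp add: closedin_t1_singleton)
  moreover have "sc_embed X x \<in> sc_closure X {y}"
    using subset_sc_closure[of "{y}" X] y eq by auto
  ultimately show "x = y" using sc_closure_trace[OF assms(1) _ x] by blast
qed

text \<open>
  The sets of the form \<open>U \<union> T\<close> with \<open>U\<close> open in the compactification and \<open>T\<close> open in \<open>X\<close>
  contain the generators and are closed under finite intersections and arbitrary unions, so that
  declaring \<open>X\<close> open adds nothing else. The open set \<open>U\<close> in the conclusion covers the part of \<open>S\<close> in the
  remainder, while the rest of \<open>S\<close> is controlled by its trace on \<open>X\<close> alone.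
\<close>

lemma openin_stone_cech_base_open_imp:
  assumes "openin (stone_cech_base_open X) S"
  shows "S \<subseteq> topspace (stone_cech X) \<and> openin X {x \<in> topspace X. sc_embed X x \<in> S} \<and>
    (\<exists>U. openin (stone_cech X) U \<and> U \<subseteq> S \<and> S - sc_embed X ` topspace X \<subseteq> U)"
proof -
  have "generate_topology_on ({U. openin (stone_cech X) U} \<union> {sc_embed X ` topspace X}) S"
    using assms by (simp add: stone_cech_base_open_def openin_topology_generated_by)
  then show ?thesis
  proof (induction rule: generate_topology_on.induct)
    case Empty
    then show ?case by (auto intro: exI[of _ "{}"])
  next
    case (Int a b)
    then obtain U V where "openin (stone_cech X) U" "U \<subseteq> a" "a - sc_embed X ` topspace X \<subseteq> U"
      "openin (stone_cech X) V" "V \<subseteq> b" "b - sc_embed X ` topspace X \<subseteq> V" by blast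
    then have "\<exists>U. openin (stone_cech X) U \<and> U \<subseteq> a \<inter> b \<and> a \<inter> b - sc_embed X ` topspace X \<subseteq> U"
      by (intro exI[of _ "U \<inter> V"]) auto
    moreover have "{x \<in> topspace X. sc_embed X x \<in> a \<inter> b} =
        {x \<in> topspace X. sc_embed X x \<in> a} \<inter> {x \<in> topspace X. sc_embed X x \<in> b}" by auto
    ultimately show ?case using Int by auto
  next
    case (UN K)
    let ?U = "\<Union>{U. openin (stone_cech X) U \<and> U \<subseteq> \<Union>K}"
    have "\<Union>K - sc_embed X ` topspace X \<subseteq> ?U"
    proof
      fix p assume p: "p \<in> \<Union>K - sc_embed X ` topspace X"
      then obtain k where k: "k \<in> K" "p \<in> k" by auto
      obtain U where "openin (stone_cech X) U" "U \<subseteq> k" "k - sc_embed X ` topspace X \<subseteq> U"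
        using UN.IH[OF k(1)] by auto
      then show "p \<in> ?U" using k p by blast
    qed
    moreover have "openin (stone_cech X) ?U" "?U \<subseteq> \<Union>K" by blast+
    ultimately have "\<exists>U. openin (stone_cech X) U \<and> U \<subseteq> \<Union>K \<and> \<Union>K - sc_embed X ` topspace X \<subseteq> U"
      by blast
    moreover have "{x \<in> topspace X. sc_embed X x \<in> \<Union>K} =
        (\<Union>k\<in>K. {x \<in> topspace X. sc_embed X x \<in> k})" by auto
    moreover have "openin X (\<Union>k\<in>K. {x \<in> topspace X. sc_embed X x \<in> k})"
      using UN.IH by (intro openin_Union) auto
    moreover have "\<Union>K \<subseteq> topspace (stone_cech X)" using UN.IH by (simp add: Sup_le_iff)
    ultimately show ?case by simp
  next
    case (Basis s)
    then consider "openin (stone_cech X) s" | "s = sc_embed X ` topspace X" by auto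
    then show ?case
    proof cases
      case 1
      then show ?thesis
        using openin_subset openin_continuous_map_preimage[OF continuous_map_sc_embed, of X s] by blast
    next
      case 2
      then have "{x \<in> topspace X. sc_embed X x \<in> s} = topspace X" by auto
      then show ?thesis using 2 sc_embed_in_stone_cech by (auto intro: exI[of _ "{}"])
    qed
  qed
qed

lemma openin_stone_cech_base_open:
  assumes "completely_regular_space X"
  shows "openin (stone_cech_base_open X) S \<longleftrightarrow>
    S \<subseteq> topspace (stone_cech X) \<and> openin X {x \<in> topspace X. sc_embed X x \<in> S} \<and>
    (\<exists>U. openin (stone_cech X) U \<and> U \<subseteq> S \<and> S - sc_embed X ` topspace X \<subseteq> U)" (is "?L \<longleftrightarrow> ?R")
proof
  show "?L \<Longrightarrow> ?R" by (rule openin_stone_cech_base_open_imp)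
  assume R: ?R
  then obtain U where U: "openin (stone_cech X) U" "U \<subseteq> S" "S - sc_embed X ` topspace X \<subseteq> U" by blast
  have "openin X {x \<in> topspace X. sc_embed X x \<in> S}" using R by simp
  from sc_embed_open_trace[OF assms this]
  obtain T where T: "openin (stone_cech X) T"
    and T_iff: "\<forall>x\<in>topspace X. sc_embed X x \<in> T \<longleftrightarrow> sc_embed X x \<in> S"
    by auto
  have "S \<subseteq> U \<union> T \<inter> sc_embed X ` topspace X" using U(3) T_iff by blast
  moreover have "U \<union> T \<inter> sc_embed X ` topspace X \<subseteq> S" using U(2) T_iff by blast
  ultimately have S: "S = U \<union> T \<inter> sc_embed X ` topspace X" by blast
  have open_W: "openin (stone_cech_base_open X) W" if "openin (stone_cech X) W" for W
    unfolding stone_cech_base_open_def using that by (intro topology_generated_by_Basis) auto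
  have "openin (stone_cech_base_open X) (sc_embed X ` topspace X)"
    unfolding stone_cech_base_open_def by (intro topology_generated_by_Basis) auto
  from openin_Un[OF open_W[OF U(1)] openin_Int[OF open_W[OF T] this]]
  show ?L by (simp only: S[symmetric])
qed

lemma topspace_stone_cech_base_open: "topspace (stone_cech_base_open X) = topspace (stone_cech X)"
proof -
  have "\<Union>{U. openin (stone_cech X) U} = topspace (stone_cech X)"
    using openin_subset by fastforce
  then show ?thesis
    using sc_embed_in_stone_cech[of _ X] by (auto simp: stone_cech_base_open_def)
qed

section \<open>The topology of the 1-complex\<close>

text \<open>
  Vertices have singleton supports, and the inner points of an edge are exactly the points whose
  support is that edge. Arguments by support therefore replace arguments by edge and orientation.
\<close>

definition supp :: "('a \<Rightarrow> real) \<Rightarrow> 'a set" where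
  "supp z = {v. z v \<noteq> 0}"

lemma supp_vertex_point [simp]: "supp (vertex_point v) = {v}"
  by (auto simp: supp_def vertex_point_def)

lemma supp_edge_point: "x \<noteq> y \<Longrightarrow> 0 < t \<Longrightarrow> t < 1 \<Longrightarrow> supp (edge_point x y t) = {x, y}"
  by (auto simp: supp_def edge_point_def vertex_point_def)

lemma edge_point_0 [simp]: "edge_point x y 0 = vertex_point x"
  and edge_point_1 [simp]: "edge_point x y 1 = vertex_point y"
  by (auto simp: edge_point_def)

lemma edge_point_flip: "edge_point y x (1 - t) = edge_point x y t"
  by (auto simp: edge_point_def)

lemma edge_point_apply:
  assumes "x \<noteq> y"
  shows "edge_point x y t x = 1 - t" and "edge_point x y t y = t"
    and "z \<noteq> x \<Longrightarrow> z \<noteq> y \<Longrightarrow> edge_point x y t z = 0"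
  using assms by (auto simp: edge_point_def vertex_point_def)

lemma inj_edge_point: "x \<noteq> y \<Longrightarrow> edge_point x y s = edge_point x y t \<Longrightarrow> s = t"
  by (metis edge_point_apply(2))

lemma supp_edge_point_closed:
  assumes "x \<noteq> y" and "t \<in> {0..1}"
  shows "supp (edge_point x y t) = (if t = 0 then {x} else if t = 1 then {y} else {x, y})"
  using assms supp_edge_point[of x y t] by auto

locale graph_complex =
  fixes V :: "'a set" and E :: "'a set set"
  assumes simple: "simple_graph V E"
begin

abbreviation "K \<equiv> one_complex V E"

lemma edgeD:
  assumes "{x, y} \<in> E"
  shows "x \<in> V" and "y \<in> V" and "x \<noteq> y"
  using assms simple by (fastforce simp: simple_graph_def)+

lemma inner_point_in_complex: "{x, y} \<in> E \<Longrightarrow> 0 < t \<Longrightarrow> t < 1 \<Longrightarrow> edge_point x y t \<in> complex_points V E"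
  unfolding complex_points_def inner_points_def by blast

lemma vertex_point_in_complex: "v \<in> V \<Longrightarrow> vertex_point v \<in> complex_points V E"
  unfolding complex_points_def by blast

lemma edge_point_in_complex:
  assumes "{x, y} \<in> E" and "t \<in> {0..1}"
  shows "edge_point x y t \<in> complex_points V E"
  using inner_point_in_complex[OF assms(1), of t] vertex_point_in_complex edgeD[OF assms(1)] assms(2)
  by (cases "t = 0"; cases "t = 1") auto

lemma complex_point_cases:
  assumes "z \<in> complex_points V E"
  obtains (vertex) v where "v \<in> V" "z = vertex_point v"
  | (inner) x y t where "{x, y} \<in> E" "0 < t" "t < 1" "z = edge_point x y t"
  using assms unfolding complex_points_def inner_points_def by blast

lemma supp_complex_point:
  assumes "z \<in> complex_points V E"
  shows "finite (supp z)" and "supp z \<subseteq> V" and "supp z \<noteq> {}"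
  using assms by (cases z rule: complex_point_cases; auto simp: supp_edge_point edgeD)+

text \<open>
  An inner point determines its edge by its support, so it has exactly two parametrizations, one for
  each orientation of the edge.
\<close>

lemma edge_points_eq_cases:
  assumes "x \<noteq> y" "a \<noteq> b" "0 < s" "s < 1" "t \<in> {0..1}" "edge_point x y t = edge_point a b s"
  shows "x = a \<and> y = b \<and> t = s \<or> x = b \<and> y = a \<and> t = 1 - s"
proof -
  have "supp (edge_point x y t) = {a, b}"
    using assms supp_edge_point by metis
  then have xy: "{x, y} = {a, b}"
    using assms supp_edge_point_closed[of x y t] by (auto split: if_splits)
  then consider "x = a" "y = b" | "x = b" "y = a" by (auto simp: doubleton_eq_iff)
  then show ?thesis
  proof cases
    case 1
    then show ?thesis using assms inj_edge_point by metis
  next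
    case 2
    then have "edge_point a b (1 - t) = edge_point a b s" using assms(6) edge_point_flip[of a b t] by metis
    then have "1 - t = s" by (rule inj_edge_point[OF assms(2)])
    then show ?thesis using 2 by simp
  qed
qed

lemma edge_point_in_open_star:
  assumes "{x, y} \<in> E" and "t \<in> {0..1}" and r: "\<And>w. {v, w} \<in> E \<Longrightarrow> 0 < r w \<and> r w < 1"
  shows "edge_point x y t \<in> open_star E v r \<longleftrightarrow> x = v \<and> t < r y \<or> y = v \<and> 1 - t < r x"
proof
  assume L: "edge_point x y t \<in> open_star E v r"
  have xy: "x \<noteq> y" using edgeD[OF assms(1)] by simp
  show "x = v \<and> t < r y \<or> y = v \<and> 1 - t < r x"
  proof (cases "edge_point x y t = vertex_point v")
    case True
    then have "supp (edge_point x y t) = {v}" by simp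
    then have "t = 0 \<and> x = v \<or> t = 1 \<and> y = v"
      using supp_edge_point_closed[OF xy assms(2)] xy by (auto split: if_splits)
    then show ?thesis using r assms(1) by (auto simp: insert_commute)
  next
    case False
    then obtain w s where ws: "{v, w} \<in> E" "0 \<le> s" "s < r w" "edge_point x y t = edge_point v w s"
      using L by (auto simp: open_star_def)
    moreover have "s \<noteq> 0" using False ws by auto
    moreover have "v \<noteq> w" using edgeD ws(1) by blast
    moreover have "s < 1" using r[OF ws(1)] ws(3) by simp
    ultimately show ?thesis
      using edge_points_eq_cases[OF xy, of v w s t] assms(2) by auto
  qed
next
  assume R: "x = v \<and> t < r y \<or> y = v \<and> 1 - t < r x"
  then show "edge_point x y t \<in> open_star E v r"
  proof
    assume "x = v \<and> t < r y"
    then show ?thesis using assms by (auto simp: open_star_def)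
  next
    assume *: "y = v \<and> 1 - t < r x"
    have "edge_point v x (1 - t) \<in> open_star E v r"
      using assms(1,2) * by (auto simp: open_star_def insert_commute)
    then show ?thesis using * edge_point_flip by metis
  qed
qed

lemma topspace_complex: "topspace K = complex_points V E"
proof
  show "topspace K \<subseteq> complex_points V E"
  proof -
    have "edge_point x y ` {a<..<b} \<subseteq> complex_points V E" if "{x, y} \<in> E" "0 \<le> a" "b \<le> 1" for x y a b
      using edge_point_in_complex[OF that(1)] that by auto
    moreover have "open_star E v r \<subseteq> complex_points V E"
      if "v \<in> V" "\<And>w. {v, w} \<in> E \<Longrightarrow> 0 < r w \<and> r w < 1" for v r
      using vertex_point_in_complex[OF that(1)] edge_point_in_complex that(2)
      unfolding open_star_def by fastforce
    ultimately show ?thesis unfolding one_complex_def topology_generated_by_topspace by blast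
  qed
  show "complex_points V E \<subseteq> topspace K"
  proof
    fix z assume "z \<in> complex_points V E"
    then show "z \<in> topspace K"
    proof (cases z rule: complex_point_cases)
      case (vertex v)
      have "open_star E v (\<lambda>_. 1/2) \<in> {open_star E v r | v r. v \<in> V \<and> (\<forall>w. {v, w} \<in> E \<longrightarrow> 0 < r w \<and> r w < 1)}"
        using vertex by force
      moreover have "z \<in> open_star E v (\<lambda>_. 1/2)" using vertex by (simp add: open_star_def)
      ultimately show ?thesis unfolding one_complex_def topology_generated_by_topspace by blast
    next
      case (inner x y t)
      have "edge_point x y ` {0<..<1} \<in> {edge_point x y ` {a<..<b} | x y a b. {x, y} \<in> E \<and> 0 \<le> a \<and> b \<le> 1}"
        using inner by force
      moreover have "z \<in> edge_point x y ` {0<..<1}" using inner by simp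
      ultimately show ?thesis unfolding one_complex_def topology_generated_by_topspace by blast
    qed
  qed
qed

lemma openin_open_star:
  assumes "v \<in> V" "\<And>w. {v, w} \<in> E \<Longrightarrow> 0 < r w \<and> r w < 1"
  shows "openin K (open_star E v r)"
  unfolding one_complex_def using assms by (intro topology_generated_by_Basis) blast

lemma openin_edge_interval:
  assumes "{x, y} \<in> E" "0 \<le> a" "b \<le> 1"
  shows "openin K (edge_point x y ` {a<..<b})"
  unfolding one_complex_def using assms by (intro topology_generated_by_Basis) blast

text \<open>
  Preimages of point sets under the parametrization of an edge. By \<open>openin_complex\<close> below, the
  1-complex carries the weak topology with respect to its edges: openness, closedness and continuity
  can all be tested on these traces. The topological facts about \<open>G\<close> below are derived in this way.
\<close>

definition edge_trace :: "'a \<Rightarrow> 'a \<Rightarrow> ('a \<Rightarrow> real) set \<Rightarrow> real set" where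
  "edge_trace x y S = {t \<in> {0..1}. edge_point x y t \<in> S}"

lemma openin_unit_interval:
  "openin (top_of_set {0..1}) (S \<inter> {0..1})" if "open S" for S :: "real set"
  using that by (auto simp: openin_open)

lemma openin_complex_imp_trace:
  assumes "openin K U" and xy: "{x, y} \<in> E"
  shows "openin (top_of_set {0..1}) (edge_trace x y U)"
proof -
  have ne: "x \<noteq> y" using edgeD[OF xy] by simp
  have "generate_topology_on ({edge_point x y ` {a<..<b} | x y a b. {x, y} \<in> E \<and> 0 \<le> a \<and> b \<le> 1} \<union>
     {open_star E v r | v r. v \<in> V \<and> (\<forall>w. {v, w} \<in> E \<longrightarrow> 0 < r w \<and> r w < 1)}) U"
    using assms(1) unfolding one_complex_def by (rule openin_topology_generated_by)
  then show ?thesis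
  proof (induction rule: generate_topology_on.induct)
    case Empty
    then show ?case by (simp add: edge_trace_def)
  next
    case (Int a b)
    have "edge_trace x y (a \<inter> b) = edge_trace x y a \<inter> edge_trace x y b"
      by (auto simp: edge_trace_def)
    then show ?case using Int.IH by auto
  next
    case (UN \<K>)
    have "edge_trace x y (\<Union>\<K>) = \<Union>(edge_trace x y ` \<K>)"
      by (auto simp: edge_trace_def)
    then show ?case using UN.IH by (simp, intro openin_Union) auto
  next
    case (Basis s)
    then consider (interval) a b c d where "{a, b} \<in> E" "0 \<le> c" "d \<le> 1" "s = edge_point a b ` {c<..<d}"
      | (star) v r where "v \<in> V" "\<And>w. {v, w} \<in> E \<Longrightarrow> 0 < r w \<and> r w < 1" "s = open_star E v r"
      by blast
    then show ?case
    proof cases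
      case interval
      have ab: "a \<noteq> b" using edgeD[OF interval(1)] by simp
      have "edge_trace x y s = (if x = a \<and> y = b then {c<..<d} else if x = b \<and> y = a then {1-d<..<1-c} else {}) \<inter> {0..1}"
      proof (intro set_eqI iffI)
        fix t assume "t \<in> edge_trace x y s"
        then obtain s' where "t \<in> {0..1}" "s' \<in> {c<..<d}" "edge_point x y t = edge_point a b s'"
          unfolding interval edge_trace_def by auto
        then show "t \<in> (if x = a \<and> y = b then {c<..<d} else if x = b \<and> y = a then {1-d<..<1-c} else {}) \<inter> {0..1}"
          using edge_points_eq_cases[OF ne ab, of s' t] ab interval(2,3) by auto
      next
        fix t assume t: "t \<in> (if x = a \<and> y = b then {c<..<d} else if x = b \<and> y = a then {1-d<..<1-c} else {}) \<inter> {0..1}"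
        then consider "x = a" "y = b" "t \<in> {c<..<d}" | "x = b" "y = a" "1 - t \<in> {c<..<d}"
          by (auto split: if_splits)
        then have "edge_point x y t \<in> s"
        proof cases
          case 2
          then show ?thesis unfolding interval(4) using edge_point_flip[of y x t] by (metis imageI)
        qed (simp add: interval)
        then show "t \<in> edge_trace x y s" using t by (simp add: edge_trace_def)
      qed
      then show ?thesis using openin_unit_interval by (auto simp del: Int_atLeastAtMost)
    next
      case star
      have "edge_trace x y s = (if x = v then {..<r y} else if y = v then {1 - r x<..} else {}) \<inter> {0..1}"
        unfolding edge_trace_def star(3) using edge_point_in_open_star[OF xy _ star(2)] ne by auto
      then show ?thesis using openin_unit_interval by auto
    qed
  qed
qed

text \<open>
  Since the lengths of the segments that form an open star can be chosen independently of each other, a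
  star inside \<open>U\<close> around a vertex of infinite degree is found one edge at a time.
\<close>

lemma openin_complexI:
  assumes "U \<subseteq> complex_points V E"
    and trace: "\<And>x y. {x, y} \<in> E \<Longrightarrow> openin (top_of_set {0..1}) (edge_trace x y U)"
  shows "openin K U"
    and "v \<in> V \<Longrightarrow> vertex_point v \<in> U \<Longrightarrow>
      \<exists>r. (\<forall>w. {v, w} \<in> E \<longrightarrow> 0 < r w \<and> r w < 1) \<and> open_star E v r \<subseteq> U"
proof -
  have initial: "\<exists>\<delta>>0. \<delta> < 1 \<and> edge_point x y ` {0..<\<delta>} \<subseteq> U"
    if xy: "{x, y} \<in> E" and x: "vertex_point x \<in> U" for x y
  proof -
    have "0 \<in> edge_trace x y U" using x by (simp add: edge_trace_def)
    then obtain \<delta> where \<delta>: "\<delta> > 0" "\<And>t. t \<in> {0..1} \<Longrightarrow> dist t 0 < \<delta> \<Longrightarrow> t \<in> edge_trace x y U"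
      using trace[OF xy] unfolding openin_euclidean_subtopology_iff by blast
    then have "edge_point x y ` {0..<min \<delta> (1/2)} \<subseteq> U"
      by (auto simp: edge_trace_def dist_real_def)
    then show ?thesis using \<delta>(1) by (intro exI[of _ "min \<delta> (1/2)"]) auto
  qed
  show star: "\<exists>r. (\<forall>w. {v, w} \<in> E \<longrightarrow> 0 < r w \<and> r w < 1) \<and> open_star E v r \<subseteq> U"
    if v: "v \<in> V" "vertex_point v \<in> U" for v
  proof -
    define r where "r = (\<lambda>w. SOME \<delta>. 0 < \<delta> \<and> \<delta> < 1 \<and> edge_point v w ` {0..<\<delta>} \<subseteq> U)"
    have r: "0 < r w \<and> r w < 1 \<and> edge_point v w ` {0..<r w} \<subseteq> U" if "{v, w} \<in> E" for w
      unfolding r_def by (rule someI_ex) (use initial[OF that] v in auto)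
    have "open_star E v r \<subseteq> U"
      using r v by (auto simp: open_star_def)
    then show ?thesis using r by blast
  qed
  show "openin K U"
  proof (subst openin_subopen, intro ballI)
    fix z assume z: "z \<in> U"
    then have "z \<in> complex_points V E" using assms(1) by blast
    then show "\<exists>T. openin K T \<and> z \<in> T \<and> T \<subseteq> U"
    proof (cases z rule: complex_point_cases)
      case (vertex v)
      then obtain r where "\<And>w. {v, w} \<in> E \<Longrightarrow> 0 < r w \<and> r w < 1" "open_star E v r \<subseteq> U"
        using star z by metis
      moreover have "z \<in> open_star E v r" by (simp add: open_star_def vertex)
      ultimately show ?thesis using openin_open_star[OF vertex(1)] by blast
    next
      case (inner x y t)
      have "t \<in> edge_trace x y U" using z inner by (simp add: edge_trace_def)
      then obtain \<delta> where \<delta>: "\<delta> > 0" "\<And>s. s \<in> {0..1} \<Longrightarrow> dist s t < \<delta> \<Longrightarrow> s \<in> edge_trace x y U"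
        using trace[OF inner(1)] unfolding openin_euclidean_subtopology_iff by blast
      let ?I = "{max 0 (t - \<delta>)<..<min 1 (t + \<delta>)}"
      have "edge_point x y ` ?I \<subseteq> U"
        using \<delta>(2) by (auto simp: edge_trace_def dist_real_def abs_less_iff)
      moreover have "z \<in> edge_point x y ` ?I" using inner \<delta>(1) by auto
      moreover have "openin K (edge_point x y ` ?I)" using openin_edge_interval inner(1) by simp
      ultimately show ?thesis by blast
    qed
  qed
qed

lemma openin_complex:
  "openin K U \<longleftrightarrow> U \<subseteq> complex_points V E \<and>
    (\<forall>x y. {x, y} \<in> E \<longrightarrow> openin (top_of_set {0..1}) (edge_trace x y U))"
proof (intro iffI conjI allI impI)
  show "U \<subseteq> complex_points V E" if "openin K U"
    using openin_subset[OF that] topspace_complex by simp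
qed (auto intro: openin_complex_imp_trace openin_complexI(1))

lemma open_star_subset_open:
  assumes "openin K U" and "v \<in> V" and "vertex_point v \<in> U"
  shows "\<exists>r. (\<forall>w. {v, w} \<in> E \<longrightarrow> 0 < r w \<and> r w < 1) \<and> open_star E v r \<subseteq> U"
proof (rule openin_complexI(2)[OF _ _ assms(2,3)])
  show "U \<subseteq> complex_points V E" "\<And>x y. {x, y} \<in> E \<Longrightarrow> openin (top_of_set {0..1}) (edge_trace x y U)"
    using assms(1) openin_complex by simp_all
qed

lemma closedin_complex:
  "closedin K S \<longleftrightarrow> S \<subseteq> complex_points V E \<and>
    (\<forall>x y. {x, y} \<in> E \<longrightarrow> closedin (top_of_set {0..1}) (edge_trace x y S))"
proof -
  have "edge_trace x y (complex_points V E - S) = {0..1} - edge_trace x y S" if "{x, y} \<in> E" for x y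
    using edge_point_in_complex[OF that] by (auto simp: edge_trace_def)
  then show ?thesis
    unfolding closedin_def openin_complex topspace_complex
    by (auto simp: edge_trace_def)
qed

lemma continuous_map_complex:
  "continuous_map K Y f \<longleftrightarrow> f \<in> complex_points V E \<rightarrow> topspace Y \<and>
    (\<forall>x y. {x, y} \<in> E \<longrightarrow> continuous_map (top_of_set {0..1}) Y (\<lambda>t. f (edge_point x y t)))"
proof -
  have "edge_trace x y {z \<in> complex_points V E. f z \<in> U} = {t \<in> {0..1}. f (edge_point x y t) \<in> U}"
    if "{x, y} \<in> E" for x y U
    using edge_point_in_complex[OF that] by (auto simp: edge_trace_def)
  then show ?thesis
    unfolding continuous_map openin_complex topspace_complex
    by (auto simp: Pi_iff edge_point_in_complex)
qed

lemma continuous_map_edge_point: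
  "{x, y} \<in> E \<Longrightarrow> continuous_map (top_of_set {0..1}) K (edge_point x y)"
  using continuous_map_complex[of K id] by auto

lemma compactin_edge: "{x, y} \<in> E \<Longrightarrow> compactin K (edge_point x y ` {0..1})"
  by (rule image_compactin[OF _ continuous_map_edge_point]) (auto simp: compactin_subtopology)

text \<open>
  An edge has only three possible supports, so \<open>D\<close> meets every edge in at most three points. As the
  hypotheses pass to subsets, \<open>D\<close> is discrete as well, and no point of \<open>G\<close> outside a subset of \<open>D\<close>
  is a limit of it.
\<close>

lemma closedin_inj_on_supp:
  assumes "D \<subseteq> complex_points V E" and "inj_on supp D"
  shows "closedin K D"
  unfolding closedin_complex
proof (intro conjI allI impI assms(1))
  fix x y assume xy: "{x, y} \<in> E"
  have ne: "x \<noteq> y" using edgeD[OF xy] by simp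
  have "inj_on (\<lambda>t. supp (edge_point x y t)) (edge_trace x y D)"
  proof (rule inj_onI)
    fix s t assume "s \<in> edge_trace x y D" "t \<in> edge_trace x y D"
      and "supp (edge_point x y s) = supp (edge_point x y t)"
    then have "edge_point x y s = edge_point x y t"
      using assms(2) by (auto simp: edge_trace_def inj_on_def)
    then show "s = t" by (rule inj_edge_point[OF ne])
  qed
  moreover have "(\<lambda>t. supp (edge_point x y t)) ` edge_trace x y D \<subseteq> {{x}, {y}, {x, y}}"
    using supp_edge_point_closed[OF ne] by (auto simp: edge_trace_def)
  ultimately have "finite (edge_trace x y D)"
    by (meson finite.emptyI finite.insertI finite_imageD finite_subset)
  then show "closedin (top_of_set {0..1}) (edge_trace x y D)"
    by (intro closed_subset finite_imp_closed) (auto simp: edge_trace_def)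
qed

lemma t1_space_complex: "t1_space K"
  unfolding t1_space_closedin_singleton topspace_complex
  by (auto intro!: closedin_inj_on_supp)

lemma supp_singletonD:
  assumes "z \<in> complex_points V E" "supp z = {v}"
  shows "z = vertex_point v"
  using assms(1)
proof (cases z rule: complex_point_cases)
  case (inner x y t)
  then show ?thesis using assms(2) supp_edge_point edgeD(3)[OF inner(1)] by (metis insertI1 insertI2 singletonD insert_commute)
qed (use assms in auto)

lemma point_on_edge:
  assumes "z \<in> complex_points V E" and xy: "{x, y} \<in> E" and "supp z \<subseteq> {x, y}"
  obtains s where "s \<in> {0..1}" "z = edge_point x y s"
  using assms(1)
proof (cases z rule: complex_point_cases)
  case (vertex v)
  then have "v = x \<or> v = y" using assms(3) by auto
  then show ?thesis using that[of 0] that[of 1] vertex by auto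
next
  case (inner a b t)
  then have "{a, b} \<subseteq> {x, y}" "a \<noteq> b" using assms(3) supp_edge_point[OF edgeD(3)[OF inner(1)] inner(2,3)] edgeD(3)[OF inner(1)] by auto
  then consider "a = x" "b = y" | "a = y" "b = x" by auto
  then show ?thesis
  proof cases
    case 1
    then show ?thesis using that[of t] inner by auto
  next
    case 2
    then show ?thesis using that[of "1 - t"] inner edge_point_flip[of x y t] by auto
  qed
qed

lemma edge_point_apply_dist:
  "x \<noteq> y \<Longrightarrow> b \<in> {x, y} \<Longrightarrow> \<bar>edge_point x y t b - edge_point x y s b\<bar> = \<bar>t - s\<bar>"
  by (auto simp: edge_point_apply)

text \<open>
  A point \<open>z\<close> is separated from a closed set by a function that grows linearly from \<open>0\<close> to \<open>1\<close> along
  every edge through \<open>z\<close>, at a speed depending on the edge, and that is \<open>1\<close> everywhere else. Continuity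
  is checked on one edge at a time and hence needs no uniform bound on the speeds.
\<close>

lemma completely_regular_complex: "completely_regular_space K"
  unfolding completely_regular_space_def
proof (intro allI impI)
  fix S z assume "closedin K S \<and> z \<in> topspace K - S"
  then have S: "closedin K S" and z: "z \<in> complex_points V E" "z \<notin> S"
    by (auto simp: topspace_complex)
  obtain b where b: "b \<in> supp z" using supp_complex_point(3)[OF z(1)] by auto
  \<comment> \<open>On an edge through \<open>z\<close> the coordinate at \<open>b\<close> measures the distance from \<open>z\<close> for either orientation.
    An edge length \<open>\<delta>\<close> is good if points closer than \<open>\<delta>\<close> avoid \<open>S\<close> and are not end vertices other than \<open>z\<close>.\<close>
  define good where "good = (\<lambda>e \<delta>. 0 < \<delta> \<and> \<delta> \<le> 1 \<and> (\<forall>z'\<in>complex_points V E. supp z' \<subseteq> e \<longrightarrow>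
    \<bar>z' b - z b\<bar> < \<delta> \<longrightarrow> supp z \<subseteq> supp z' \<and> z' \<notin> S))"
  have ex_good: "\<exists>\<delta>. good e \<delta>" if e: "e \<in> E" "supp z \<subseteq> e" for e
  proof -
    obtain x y where xy: "e = {x, y}"
      using simple e(1) unfolding simple_graph_def card_2_iff by blast
    have xyE: "{x, y} \<in> E" using e(1) xy by simp
    have ne: "x \<noteq> y" using edgeD[OF xyE] by simp
    obtain s where s: "s \<in> {0..1}" "z = edge_point x y s"
      using point_on_edge[OF z(1) xyE] e(2) xy by blast
    have "closedin (top_of_set {0..1}) (edge_trace x y S)"
      using S xyE closedin_complex by blast
    then have "openin (top_of_set {0..1}) ({0..1} - edge_trace x y S)"
      by (simp add: closedin_def)
    moreover have "s \<in> {0..1} - edge_trace x y S"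
      using s z by (simp add: edge_trace_def)
    ultimately obtain \<delta> where \<delta>: "\<delta> > 0" "\<And>t. t \<in> {0..1} \<Longrightarrow> dist t s < \<delta> \<Longrightarrow> t \<in> {0..1} - edge_trace x y S"
      unfolding openin_euclidean_subtopology_iff by blast
    \<comment> \<open>The last two entries are the distances to the ends of the edge, skipping an end that equals \<open>z\<close>.\<close>
    let ?\<delta> = "Min {\<delta>, 1, (if s > 0 then s else 1), (if s < 1 then 1 - s else 1)}"
    have small: "supp z \<subseteq> supp z' \<and> z' \<notin> S"
      if z': "z' \<in> complex_points V E" "supp z' \<subseteq> e" and d: "\<bar>z' b - z b\<bar> < ?\<delta>" for z'
    proof -
      obtain t where t: "t \<in> {0..1}" "z' = edge_point x y t"
        using point_on_edge[OF z'(1) xyE] z'(2) xy by blast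
      have "\<bar>t - s\<bar> < ?\<delta>"
        using d edge_point_apply_dist[OF ne, of b t s] b e(2) t s xy by auto
      then have ts: "\<bar>t - s\<bar> < \<delta>" "s > 0 \<Longrightarrow> t > 0" "s < 1 \<Longrightarrow> t < 1" by auto
      have "t \<notin> edge_trace x y S" using \<delta>(2)[of t] t ts by (simp add: dist_real_def)
      then have "z' \<notin> S" using t by (simp add: edge_trace_def)
      moreover have "supp z \<subseteq> supp z'"
        using ts(2,3) t s supp_edge_point_closed[OF ne] by auto
      ultimately show ?thesis by simp
    qed
    have "0 < ?\<delta>" "?\<delta> \<le> 1" using \<delta>(1) by auto
    then have "good e ?\<delta>" unfolding good_def using small by blast
    then show ?thesis by blast
  qed
  define r where "r = (\<lambda>e. SOME \<delta>. good e \<delta>)"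
  have r: "good e (r e)" if "e \<in> E" "supp z \<subseteq> e" for e
    unfolding r_def by (rule someI_ex[OF ex_good[OF that]])
  define f where "f = (\<lambda>z'. if supp z \<subseteq> supp z' then min 1 (\<bar>z' b - z b\<bar> / r (supp z')) else 1)"
  have same_vertex: "z' = z" if "z' \<in> complex_points V E" "supp z' = {v}" "supp z \<subseteq> supp z'" for z' v
  proof -
    have "supp z = {v}" using supp_complex_point(3)[OF z(1)] that by auto
    then show ?thesis using supp_singletonD z(1) that by metis
  qed
  have f_edge: "f z' = min 1 (\<bar>z' b - z b\<bar> / r {x, y})"
    if xy: "{x, y} \<in> E" "supp z \<subseteq> {x, y}" and z': "z' \<in> complex_points V E" "supp z' \<subseteq> {x, y}" for x y z'
  proof (cases "supp z \<subseteq> supp z'")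
    case True
    show ?thesis
    proof (cases "supp z' = {x, y}")
      case True
      then show ?thesis using xy by (simp add: f_def)
    next
      case False
      then have "\<exists>v. supp z' = {v}" using z' supp_complex_point(3)[OF z'(1)] by auto
      then have "z' = z" using same_vertex z'(1) True by blast
      then show ?thesis by (simp add: f_def)
    qed
  next
    case False
    then have "r {x, y} \<le> \<bar>z' b - z b\<bar>" "0 < r {x, y}"
      using r[OF xy] z' unfolding good_def by fastforce+
    then show ?thesis using False by (simp add: f_def)
  qed
  have f01: "f z' \<in> {0..1}" if "z' \<in> complex_points V E" for z'
    using that
  proof (cases z' rule: complex_point_cases)
    case (vertex v)
    then show ?thesis using same_vertex[OF that, of v] by (simp add: f_def)
  next
    case (inner x y t)
    have "supp z' = {x, y}" using inner edgeD[OF inner(1)] supp_edge_point by metis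
    then have "supp z \<subseteq> supp z' \<longrightarrow> 0 < r (supp z')" using r inner(1) good_def by auto
    then show ?thesis by (auto simp: f_def)
  qed
  have "continuous_map K euclideanreal f"
    unfolding continuous_map_complex
  proof (intro conjI allI impI)
    fix x y assume xy: "{x, y} \<in> E"
    have ne: "x \<noteq> y" using edgeD[OF xy] by simp
    have sub: "supp (edge_point x y t) \<subseteq> {x, y}" if "t \<in> {0..1}" for t
      using supp_edge_point_closed[OF ne that] by auto
    have "continuous_on {0..1} (\<lambda>t. f (edge_point x y t))"
    proof (cases "supp z \<subseteq> {x, y}")
      case True
      have "continuous_on {0..1} (\<lambda>t. min 1 (\<bar>edge_point x y t b - z b\<bar> / r {x, y}))"
        using r[OF xy True] unfolding edge_point_def good_def
        by (intro continuous_intros) auto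
      then show ?thesis
        by (rule continuous_on_eq) (use f_edge[OF xy True] edge_point_in_complex[OF xy] sub in auto)
    next
      case False
      have "f (edge_point x y t) = 1" if "t \<in> {0..1}" for t
        using sub[OF that] False unfolding f_def by auto
      then show ?thesis by (auto intro: continuous_on_eq[OF continuous_on_const[of _ 1]])
    qed
    then show "continuous_map (top_of_set {0..1}) euclideanreal (\<lambda>t. f (edge_point x y t))"
      by simp
  qed auto
  then have "continuous_map K (top_of_set {0..1}) f"
    using f01 by (auto simp: continuous_map_in_subtopology topspace_complex)
  moreover have "f z = 0" by (simp add: f_def)
  moreover have "f z' = 1" if z': "z' \<in> S" for z'
  proof -
    have z'K: "z' \<in> complex_points V E" using z' S closedin_complex by blast
    then show ?thesis
    proof (cases z' rule: complex_point_cases)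
      case (vertex v)
      then have "\<not> supp z \<subseteq> supp z'" using same_vertex[OF z'K, of v] z' z(2) by auto
      then show ?thesis by (simp add: f_def)
    next
      case (inner x y t)
      have sz': "supp z' = {x, y}" using inner edgeD[OF inner(1)] supp_edge_point by metis
      show ?thesis
      proof (cases "supp z \<subseteq> {x, y}")
        case True
        then have "r {x, y} \<le> \<bar>z' b - z b\<bar>" "0 < r {x, y}"
          using r[OF inner(1) True] z' z'K sz' unfolding good_def by fastforce+
        then show ?thesis using sz' by (simp add: f_def)
      next
        case False
        then show ?thesis using sz' by (simp add: f_def)
      qed
    qed
  qed
  ultimately show "\<exists>f. continuous_map K (top_of_set {0..1}) f \<and> f z = (0::real) \<and> f ` S \<subseteq> {1}"
    by blast
qed


section \<open>Neighbourhoods of vertex sets in the 1-complex\<close>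

text \<open>
  For a set \<open>\<C>\<close> of components of \<open>G - X\<close>, the hull of \<open>\<Union>\<C>\<close> consists of \<open>\<Union>\<C>\<close> together with the
  inner points of the edges between \<open>X\<close> and \<open>\<Union>\<C>\<close>; see \<open>tangle_nbhd_eq\<close>.
\<close>

definition open_hull :: "'a set \<Rightarrow> ('a \<Rightarrow> real) set" where
  "open_hull W = {z \<in> complex_points V E. supp z \<inter> W \<noteq> {}}"

definition full_subcomplex :: "'a set \<Rightarrow> ('a \<Rightarrow> real) set" where
  "full_subcomplex X = {z \<in> complex_points V E. supp z \<subseteq> X}"

lemma open_hull_mono: "W \<subseteq> W' \<Longrightarrow> open_hull W \<subseteq> open_hull W'"
  by (auto simp: open_hull_def)

lemma open_hull_Un: "open_hull (W \<union> W') = open_hull W \<union> open_hull W'"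
  by (auto simp: open_hull_def)

lemma open_hull_empty [simp]: "open_hull {} = {}"
  by (auto simp: open_hull_def)

lemma open_hull_subset: "open_hull W \<subseteq> topspace K"
  by (auto simp: open_hull_def topspace_complex)

lemma vertex_point_in_open_hull: "v \<in> V \<Longrightarrow> vertex_point v \<in> open_hull W \<longleftrightarrow> v \<in> W"
  by (simp add: open_hull_def vertex_point_in_complex)

lemma complex_eq_Un: "V \<subseteq> W \<union> X \<Longrightarrow> topspace K = open_hull W \<union> full_subcomplex X"
  unfolding topspace_complex open_hull_def full_subcomplex_def
  using supp_complex_point(2) by blast

lemma edge_trace_open_hull:
  assumes "{x, y} \<in> E"
  shows "edge_trace x y (open_hull W) = {t \<in> {0..1}. x \<in> W \<and> t < 1 \<or> y \<in> W \<and> 0 < t}"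
  using supp_edge_point_closed[OF edgeD(3)[OF assms]] edge_point_in_complex[OF assms]
  by (auto simp: edge_trace_def open_hull_def split: if_splits)

lemma openin_open_hull: "openin K (open_hull W)"
  unfolding openin_complex
proof (intro conjI allI impI)
  fix x y assume xy: "{x, y} \<in> E"
  have "edge_trace x y (open_hull W) =
      ((if x \<in> W then {..<1} else {}) \<union> (if y \<in> W then {0<..} else {})) \<inter> {0..1}"
    unfolding edge_trace_open_hull[OF xy] by auto
  then show "openin (top_of_set {0..1}) (edge_trace x y (open_hull W))"
    by (simp only:) (intro openin_unit_interval open_Un; simp)
qed (auto simp: open_hull_def)

text \<open>
  A finite vertex set spans finitely many edges. This is why \<open>G[X]\<close> gains no new points under closure
  in the Stone-Cech compactification.
\<close>

lemma compactin_full_subcomplex: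
  assumes "finite X"
  shows "compactin K (full_subcomplex X)"
proof -
  let ?\<C> = "(\<lambda>v. {vertex_point v}) ` (X \<inter> V) \<union>
    (\<lambda>(x, y). edge_point x y ` {0..1}) ` {(x, y) \<in> X \<times> X. {x, y} \<in> E}"
  have "full_subcomplex X = \<Union>?\<C>"
  proof (intro set_eqI iffI)
    fix z assume z: "z \<in> full_subcomplex X"
    then have "z \<in> complex_points V E" by (simp add: full_subcomplex_def)
    then show "z \<in> \<Union>?\<C>"
    proof (cases z rule: complex_point_cases)
      case (vertex v)
      then show ?thesis using z by (auto simp: full_subcomplex_def)
    next
      case (inner x y t)
      then have "supp z = {x, y}" using supp_edge_point edgeD(3) by metis
      then have "(x, y) \<in> {(x, y) \<in> X \<times> X. {x, y} \<in> E}"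
        using z inner by (auto simp: full_subcomplex_def)
      moreover have "z \<in> edge_point x y ` {0..1}" using inner by auto
      ultimately show ?thesis by blast
    qed
  next
    fix z assume "z \<in> \<Union>?\<C>"
    then consider (1) v where "v \<in> X \<inter> V" "z = vertex_point v"
      | (2) x y t where "x \<in> X" "y \<in> X" "{x, y} \<in> E" "t \<in> {0..1}" "z = edge_point x y t"
      by blast
    then show "z \<in> full_subcomplex X"
    proof cases
      case 1
      then show ?thesis by (simp add: full_subcomplex_def vertex_point_in_complex)
    next
      case 2
      then show ?thesis
        using edge_point_in_complex supp_edge_point_closed[OF edgeD(3)[OF 2(3)] 2(4)]
        by (auto simp: full_subcomplex_def)
    qed
  qed
  moreover have "finite ?\<C>"
  proof -
    have "finite {(x, y) \<in> X \<times> X. {x, y} \<in> E}"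
      by (rule finite_subset[of _ "X \<times> X"]) (use assms in auto)
    then show ?thesis using assms by simp
  qed
  moreover have "compactin K C" if "C \<in> ?\<C>" for C
    using that compactin_edge by (auto simp: topspace_complex vertex_point_in_complex)
  ultimately show ?thesis by (simp only: compactin_Union)
qed

definition edge_boundary_within :: "'a set \<Rightarrow> 'a set \<Rightarrow> bool" where
  "edge_boundary_within W X \<longleftrightarrow> (\<forall>x y. {x, y} \<in> E \<longrightarrow> x \<in> W \<longrightarrow> y \<in> W \<union> X)"

text \<open>
  An edge with an end in \<open>W\<close> has both ends in \<open>W \<union> X\<close>. Its points outside the hull of \<open>W\<close> lie in
  \<open>G[X]\<close>, where \<open>h\<close> is zero anyway, so on such an edge the cut-off function equals \<open>h\<close>; on all
  other edges it is zero.
\<close>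

lemma continuous_map_cut_off:
  assumes "edge_boundary_within W X" and h: "continuous_map K euclideanreal h"
    and "\<And>z. z \<in> full_subcomplex X \<Longrightarrow> h z = 0"
  shows "continuous_map K euclideanreal (\<lambda>z. if z \<in> open_hull W then h z else 0)" (is "continuous_map K _ ?g")
  unfolding continuous_map_complex
proof (intro conjI allI impI)
  fix x y assume xy: "{x, y} \<in> E"
  have yx: "{y, x} \<in> E" using xy by (simp add: insert_commute)
  have sub: "supp (edge_point x y t) \<subseteq> {x, y}" if "t \<in> {0..1}" for t
    using supp_edge_point_closed[OF edgeD(3)[OF xy] that] by auto
  have hxy: "continuous_map (top_of_set {0..1}) euclideanreal (\<lambda>t. h (edge_point x y t))"
    using h xy unfolding continuous_map_complex by blast
  show "continuous_map (top_of_set {0..1}) euclideanreal (\<lambda>t. ?g (edge_point x y t))"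
  proof (cases "x \<in> W \<or> y \<in> W")
    case True
    then have "{x, y} \<subseteq> W \<union> X"
      using assms(1) xy yx unfolding edge_boundary_within_def by blast
    have "h (edge_point x y t) = ?g (edge_point x y t)" if t: "t \<in> topspace (top_of_set {0..1})" for t
    proof (cases "edge_point x y t \<in> open_hull W")
      case False
      have "t \<in> {0..1}" using t by simp
      then have "edge_point x y t \<in> full_subcomplex X"
        using False sub[of t] edge_point_in_complex[OF xy] \<open>{x, y} \<subseteq> W \<union> X\<close>
        unfolding open_hull_def full_subcomplex_def by blast
      then show ?thesis using False assms(3) by simp
    qed simp
    then show ?thesis using continuous_map_eq[OF hxy, of "\<lambda>t. ?g (edge_point x y t)"] by blast
  next
    case False
    have "0 = ?g (edge_point x y t)" if "t \<in> topspace (top_of_set {0..1})" for t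
      using sub[of t] that False by (auto simp: open_hull_def)
    then show ?thesis
      using continuous_map_eq[of "top_of_set {0..1}" euclideanreal "\<lambda>_. 0" "\<lambda>t. ?g (edge_point x y t)"]
      by simp
  qed
qed auto

text \<open>
  Removing whole segments at the vertices outside \<open>W\<close> turns the open hull into a closed set, and
  leaves the induced subgraph on \<open>W\<close> with its outgoing edges shortened. The stars around all vertices
  outside \<open>W\<close> are removed, rather than those around a finite separator, so that these sets increase with
  \<open>W\<close>.
\<close>

definition trimmed_hull :: "('a \<Rightarrow> 'a \<Rightarrow> real) \<Rightarrow> 'a set \<Rightarrow> ('a \<Rightarrow> real) set" where
  "trimmed_hull r W = open_hull W - (\<Union>v\<in>V - W. open_star E v (r v))"

definition star_radii :: "('a \<Rightarrow> 'a \<Rightarrow> real) \<Rightarrow> bool" where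
  "star_radii r \<longleftrightarrow> (\<forall>v w. {v, w} \<in> E \<longrightarrow> 0 < r v w \<and> r v w < 1)"

lemma star_radiiD: "star_radii r \<Longrightarrow> {v, w} \<in> E \<Longrightarrow> 0 < r v w \<and> r v w < 1"
  by (simp add: star_radii_def)

lemma trimmed_hull_mono: "W \<subseteq> W' \<Longrightarrow> trimmed_hull r W \<subseteq> trimmed_hull r W'"
  unfolding trimmed_hull_def using open_hull_mono[of W W'] by blast

context
  fixes r :: "'a \<Rightarrow> 'a \<Rightarrow> real"
  assumes star_radii: "star_radii r"
begin

lemmas radii = star_radiiD[OF star_radii]

text \<open>
  Trimming cuts an edge exactly at its ends outside \<open>W\<close>, so on every edge a single closed interval,
  possibly empty, is left. Both closedness and connectedness of the trimmed hull come from this.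
\<close>

lemma edge_trace_trimmed_hull:
  assumes xy: "{x, y} \<in> E"
  shows "edge_trace x y (trimmed_hull r W) =
    (if x \<in> W \<or> y \<in> W then {if x \<in> W then 0 else r x y .. if y \<in> W then 1 else 1 - r y x} else {})"
proof -
  have yx: "{y, x} \<in> E" using xy by (simp add: insert_commute)
  have "edge_point x y t \<in> (\<Union>v\<in>V - W. open_star E v (r v)) \<longleftrightarrow> x \<notin> W \<and> t < r x y \<or> y \<notin> W \<and> 1 - t < r y x"
    if "t \<in> {0..1}" for t
    using edge_point_in_open_star[OF xy that radii] edgeD[OF xy] by auto
  then have "edge_trace x y (trimmed_hull r W) = {t \<in> edge_trace x y (open_hull W).
      \<not> (x \<notin> W \<and> t < r x y \<or> y \<notin> W \<and> 1 - t < r y x)}"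
    by (auto simp: edge_trace_def trimmed_hull_def)
  moreover have "t \<in> {0..1} \<and> (x \<in> W \<and> t < 1 \<or> y \<in> W \<and> 0 < t) \<and>
      \<not> (x \<notin> W \<and> t < r x y \<or> y \<notin> W \<and> 1 - t < r y x) \<longleftrightarrow>
    t \<in> (if x \<in> W \<or> y \<in> W then {if x \<in> W then 0 else r x y .. if y \<in> W then 1 else 1 - r y x} else {})"
    for t
    using radii[OF xy] radii[OF yx] by (cases "x \<in> W"; cases "y \<in> W"; simp; linarith)
  ultimately show ?thesis
    unfolding edge_trace_open_hull[OF xy] by blast
qed

lemma closedin_trimmed_hull: "closedin K (trimmed_hull r W)"
  unfolding closedin_complex
proof (intro conjI allI impI)
  fix x y assume xy: "{x, y} \<in> E"
  have "edge_trace x y (trimmed_hull r W) \<subseteq> {0..1}" by (auto simp: edge_trace_def)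
  moreover have "closed (edge_trace x y (trimmed_hull r W))"
    unfolding edge_trace_trimmed_hull[OF xy] by simp
  ultimately show "closedin (top_of_set {0..1}) (edge_trace x y (trimmed_hull r W))"
    by (rule closed_subset)
qed (auto simp: trimmed_hull_def open_hull_def)

lemma vertex_point_in_trimmed_hull:
  assumes "v \<in> V"
  shows "vertex_point v \<in> trimmed_hull r W \<longleftrightarrow> v \<in> W"
proof -
  have "vertex_point v \<notin> open_star E u (r u)" if "u \<in> V - W" "v \<in> W" for u
  proof
    assume "vertex_point v \<in> open_star E u (r u)"
    moreover have "vertex_point v \<noteq> vertex_point u"
      using that supp_vertex_point by (metis DiffD2 singleton_inject)
    ultimately obtain w t where w: "{u, w} \<in> E" "0 \<le> t" "t < r u w" "vertex_point v = edge_point u w t"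
      by (auto simp: open_star_def)
    then have "t \<in> {0..1}" "t \<noteq> 1" using radii[OF w(1)] by auto
    then have "u \<in> supp (edge_point u w t)"
      using supp_edge_point_closed[OF edgeD(3)[OF w(1)], of t] by auto
    then have "u = v" using w(4) by (metis singletonD supp_vertex_point)
    then show False using that by simp
  qed
  then show ?thesis
    using vertex_point_in_open_hull[OF assms, of W] by (auto simp: trimmed_hull_def)
qed

lemma connectedin_edge_part:
  assumes xy: "{x, y} \<in> E" and "{a..b} \<subseteq> {0..1}"
  shows "connectedin K (edge_point x y ` {a..b})"
  by (rule connectedin_continuous_map_image[OF continuous_map_edge_point[OF xy]])
     (use assms(2) in \<open>auto simp: connectedin_subtopology\<close>)

lemma connectedin_trimmed_hull:
  assumes "W \<subseteq> V" and joined: "\<And>u v. u \<in> W \<Longrightarrow> v \<in> W \<Longrightarrow> (u, v) \<in> joined_within E W"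
  shows "connectedin K (trimmed_hull r W)"
proof -
  let ?T = "trimmed_hull r W"
  let ?X = "subtopology K ?T"
  have sub: "?T \<subseteq> topspace K"
    using open_hull_subset[of W] by (auto simp: trimmed_hull_def)
  have part: "connected_component_of ?X (edge_point x y s) (edge_point x y t)"
    if xy: "{x, y} \<in> E" and st: "s \<in> edge_trace x y ?T" "t \<in> edge_trace x y ?T" for x y s t
  proof -
    define a b where "a = (if x \<in> W then 0 else r x y)" and "b = (if y \<in> W then 1 else 1 - r y x)"
    have tr: "edge_trace x y ?T = {a..b}"
      using edge_trace_trimmed_hull[OF xy, of W] st by (auto simp: a_def b_def split: if_splits)
    have "{a..b} \<subseteq> {0..1}"
      unfolding tr[symmetric] edge_trace_def by blast
    then have "connectedin K (edge_point x y ` {a..b})"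
      by (rule connectedin_edge_part[OF xy])
    moreover have "edge_point x y ` {a..b} \<subseteq> ?T"
      unfolding tr[symmetric] edge_trace_def by blast
    ultimately have "connectedin ?X (edge_point x y ` {a..b})"
      by (simp add: connectedin_subtopology)
    moreover have "edge_point x y s \<in> edge_point x y ` {a..b}" "edge_point x y t \<in> edge_point x y ` {a..b}"
      using st unfolding tr by simp_all
    ultimately show ?thesis
      unfolding connected_component_of_def by blast
  qed
  have adjacent: "connected_component_of ?X (vertex_point u) (vertex_point v)"
    if "u \<in> W" "v \<in> W" "{u, v} \<in> E" for u v
  proof -
    have "vertex_point u \<in> ?T" "vertex_point v \<in> ?T"
      using that vertex_point_in_trimmed_hull assms(1) by blast+
    then have "0 \<in> edge_trace u v ?T" "1 \<in> edge_trace u v ?T"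
      by (simp_all add: edge_trace_def)
    from part[OF that(3) this] show ?thesis by simp
  qed
  have vertices: "connected_component_of ?X (vertex_point u) (vertex_point v)" if uv: "u \<in> W" "v \<in> W" for u v
    using joined[OF uv] unfolding joined_within_def
  proof (induction rule: rtrancl_induct)
    case base
    have "vertex_point u \<in> topspace ?X"
      using vertex_point_in_trimmed_hull uv(1) assms(1) sub by (auto simp: topspace_complex)
    then show ?case by (simp add: connected_component_of_refl)
  next
    case (step v w)
    then have "connected_component_of ?X (vertex_point v) (vertex_point w)" using adjacent by simp
    then show ?case using step.IH connected_component_of_trans by metis
  qed
  have near: "\<exists>v\<in>W. connected_component_of ?X z (vertex_point v)" if z: "z \<in> ?T" for z
  proof -
    have "z \<in> complex_points V E" using z sub topspace_complex by blast
    then show ?thesis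
    proof (cases z rule: complex_point_cases)
      case (vertex v)
      then have "v \<in> W" using vertex_point_in_trimmed_hull z by blast
      then show ?thesis using vertices vertex by blast
    next
      case (inner x y t)
      have t: "t \<in> edge_trace x y ?T" using inner z by (simp add: edge_trace_def)
      then have "x \<in> W \<or> y \<in> W" using edge_trace_trimmed_hull[OF inner(1), of W] by (auto split: if_splits)
      then show ?thesis
      proof
        assume x: "x \<in> W"
        then have "vertex_point x \<in> ?T"
          using vertex_point_in_trimmed_hull assms(1) by blast
        then have "0 \<in> edge_trace x y ?T"
          by (simp add: edge_trace_def)
        from part[OF inner(1) t this] show ?thesis using inner x by auto
      next
        assume y: "y \<in> W"
        then have "vertex_point y \<in> ?T"
          using vertex_point_in_trimmed_hull assms(1) by blast
        then have "1 \<in> edge_trace x y ?T"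
          by (simp add: edge_trace_def)
        from part[OF inner(1) t this] show ?thesis using inner y by auto
      qed
    qed
  qed
  have "connected_component_of ?X z z'" if zz': "z \<in> ?T" "z' \<in> ?T" for z z'
  proof -
    obtain u v where "u \<in> W" "v \<in> W" "connected_component_of ?X z (vertex_point u)"
      "connected_component_of ?X z' (vertex_point v)"
      using near[OF zz'(1)] near[OF zz'(2)] by blast
    then show ?thesis
      using vertices connected_component_of_trans connected_component_of_sym by metis
  qed
  then have "connected_space ?X"
    unfolding connected_space_iff_connected_component by simp
  then show ?thesis using sub by (simp add: connectedin_def)
qed

end

section \<open>Closures in the Stone-Cech compactification\<close>

abbreviation "B \<equiv> stone_cech K"
abbreviation "\<iota> \<equiv> sc_embed K"
abbreviation "cl \<equiv> sc_closure K"
abbreviation "R \<equiv> stone_cech_remainder K"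

lemma remainder_iff: "p \<in> R \<longleftrightarrow> p \<in> topspace B \<and> p \<notin> \<iota> ` topspace K"
  by (simp add: stone_cech_remainder_def)

lemma open_hull_disjoint:
  assumes "edge_boundary_within W X" and "W \<inter> W' = {}" "W' \<inter> X = {}"
  shows "open_hull W \<inter> open_hull W' = {}"
proof (rule ccontr)
  assume "open_hull W \<inter> open_hull W' \<noteq> {}"
  then obtain z where z: "z \<in> complex_points V E" "supp z \<inter> W \<noteq> {}" "supp z \<inter> W' \<noteq> {}"
    by (auto simp: open_hull_def)
  from z(1) show False
  proof (cases z rule: complex_point_cases)
    case (vertex v)
    then show ?thesis using z assms by auto
  next
    case (inner x y t)
    then have "supp z = {x, y}" using supp_edge_point edgeD(3) by metis
    moreover obtain a b where ab: "a \<in> supp z" "a \<in> W" "b \<in> supp z" "b \<in> W'" using z(2,3) by blast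
    moreover have "a \<noteq> b" using ab assms(2) by blast
    ultimately have "{x, y} = {a, b}" by auto
    then have "{a, b} \<in> E" using inner(1) by (simp only:)
    then have "b \<in> W \<union> X"
      using assms(1) ab(2) unfolding edge_boundary_within_def by blast
    then show ?thesis using ab(4) assms(2,3) by blast
  qed
qed

text \<open>
  Choose a continuous function on the compactification that is \<open>0\<close> on \<open>G[X]\<close> and \<open>1\<close> at \<open>p\<close>, and set
  it to zero outside the hull of \<open>W\<close>. The extension of the result to the compactification is \<open>1\<close> at
  \<open>p\<close> if \<open>p\<close> is a limit of the hull of \<open>W\<close>, and \<open>0\<close> at \<open>p\<close> if \<open>p\<close> is a limit of the hull of
  \<open>W'\<close>. Points of \<open>G[X]\<close> itself can be limits of both hulls, so \<open>p\<close> has to lie in the remainder.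
\<close>

lemma cl_disjoint_on_remainder:
  assumes "finite X" and W: "edge_boundary_within W X"
    and W': "W \<inter> W' = {}" "W' \<inter> X = {}" and p: "p \<in> R" "p \<in> cl (open_hull W)"
  shows "p \<notin> cl (open_hull W')"
proof
  assume p': "p \<in> cl (open_hull W')"
  have "closedin B (\<iota> ` full_subcomplex X)"
    using closedin_sc_closure[of K "full_subcomplex X"] sc_closure_compact[OF compactin_full_subcomplex[OF assms(1)]]
    by simp
  moreover have "p \<notin> \<iota> ` full_subcomplex X"
    using p(1) compactin_subset_topspace[OF compactin_full_subcomplex[OF assms(1)]] by (auto simp: remainder_iff)
  moreover have "completely_regular_space B"
    by (intro normal_imp_completely_regular_space compact_Hausdorff_or_regular_imp_normal_space
        compact_space_stone_cech) (auto intro: Hausdorff_space_stone_cech)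
  ultimately obtain k where k: "continuous_map B (top_of_set {0..1}) k" "k p = (0::real)"
      "k ` \<iota> ` full_subcomplex X \<subseteq> {1}"
    using completely_regular_spaceD[of B "\<iota> ` full_subcomplex X" p] p(1) remainder_iff by auto
  define h where "h = (\<lambda>z. 1 - k (\<iota> z))"
  have kK: "continuous_map K (top_of_set {0..1}) (\<lambda>z. k (\<iota> z))"
    using continuous_map_compose[OF continuous_map_sc_embed k(1)] by (simp add: o_def)
  have hcont: "continuous_map K euclideanreal h"
    using kK unfolding h_def continuous_map_in_subtopology by (auto intro!: continuous_intros)
  have h01: "h z \<in> {0..1}" if "z \<in> topspace K" for z
    using kK that unfolding h_def continuous_map_in_subtopology by auto
  have h0: "h z = 0" if "z \<in> full_subcomplex X" for z
    using k(3) that unfolding h_def by auto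
  let ?g = "\<lambda>z. if z \<in> open_hull W then h z else 0"
  have "continuous_map K euclideanreal ?g"
    by (rule continuous_map_cut_off[OF W hcont h0])
  then have "continuous_map K (top_of_set {0..1}) ?g"
    using h01 by (auto simp: continuous_map_in_subtopology)
  from stone_cech_extension[OF this]
  obtain g where g: "continuous_map B euclideanreal g" and g_eq: "\<And>z. z \<in> topspace K \<Longrightarrow> g (\<iota> z) = ?g z"
    by blast
  have kcont: "continuous_map B euclideanreal k"
    using k(1) by (simp add: continuous_map_in_subtopology)
  have "g p = 1 - k p"
  proof (rule forall_in_closure_of_eq[where Y = euclideanreal, OF p(2)[unfolded sc_closure_def]])
    show "continuous_map B euclideanreal (\<lambda>q. 1 - k q)"
      by (intro continuous_intros kcont)
    show "g q = 1 - k q" if "q \<in> \<iota> ` open_hull W" for q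
      using that g_eq subsetD[OF open_hull_subset] by (auto simp: h_def)
  qed (auto simp: g)
  moreover have "g p = 0"
  proof (rule forall_in_closure_of_eq[where Y = euclideanreal, OF p'[unfolded sc_closure_def]])
    have "open_hull W \<inter> open_hull W' = {}"
      by (rule open_hull_disjoint[OF W W'])
    then show "g q = 0" if "q \<in> \<iota> ` open_hull W'" for q
      using that g_eq subsetD[OF open_hull_subset] by auto
  qed (auto simp: g)
  ultimately show False using k(2) by simp
qed

lemma remainder_subset_cl_cofinite_hull:
  assumes "finite X" and "V \<subseteq> W \<union> X" and "p \<in> R"
  shows "p \<in> cl (open_hull W)"
proof -
  have "p \<in> cl (open_hull W) \<union> cl (full_subcomplex X)"
    using assms(3) sc_closure_topspace[of K] complex_eq_Un[OF assms(2)] sc_closure_Un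
    by (metis remainder_iff)
  moreover have "p \<notin> cl (full_subcomplex X)"
    using sc_closure_compact[OF compactin_full_subcomplex[OF assms(1)]] assms(3)
      compactin_subset_topspace[OF compactin_full_subcomplex[OF assms(1)]]
    by (auto simp: remainder_iff)
  ultimately show ?thesis by blast
qed

end

section \<open>Components\<close>

lemma joined_within_sym: "(u, v) \<in> joined_within E W \<Longrightarrow> (v, u) \<in> joined_within E W"
proof -
  have "sym {(u, v). u \<in> W \<and> v \<in> W \<and> {u, v} \<in> E}"
    by (auto simp: sym_def insert_commute)
  then show "(u, v) \<in> joined_within E W \<Longrightarrow> (v, u) \<in> joined_within E W"
    unfolding joined_within_def by (meson sym_rtrancl symD)
qed

lemma joined_within_trans:
  "(u, v) \<in> joined_within E W \<Longrightarrow> (v, w) \<in> joined_within E W \<Longrightarrow> (u, w) \<in> joined_within E W"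
  unfolding joined_within_def by (rule rtrancl_trans)

lemma joined_within_mono: "W \<subseteq> W' \<Longrightarrow> joined_within E W \<subseteq> joined_within E W'"
  unfolding joined_within_def by (intro rtrancl_mono) auto

lemma joined_within_target: "(u, v) \<in> joined_within E W \<Longrightarrow> u \<in> W \<Longrightarrow> v \<in> W"
  unfolding joined_within_def by (induction rule: rtrancl_induct) auto

lemma compsE:
  assumes "C \<in> comps V E X"
  obtains u where "u \<in> V - X" "C = joined_within E (V - X) `` {u}"
  using assms by (auto simp: comps_def)

lemma comps_subset: "C \<in> comps V E X \<Longrightarrow> C \<subseteq> V - X"
  using joined_within_target by (fastforce elim!: compsE)

lemma comps_nonempty: "C \<in> comps V E X \<Longrightarrow> C \<noteq> {}"
  by (auto elim!: compsE simp: joined_within_def)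

lemma Union_comps: "\<Union>(comps V E X) = V - X"
proof
  show "\<Union>(comps V E X) \<subseteq> V - X" by (rule Union_least) (rule comps_subset)
  show "V - X \<subseteq> \<Union>(comps V E X)" unfolding comps_def joined_within_def by blast
qed

lemma comps_joined:
  assumes "C \<in> comps V E X" "u \<in> C"
  shows "C = joined_within E (V - X) `` {u}"
  using assms joined_within_sym joined_within_trans by (fast elim!: compsE)

lemma comps_eq: "C \<in> comps V E X \<Longrightarrow> D \<in> comps V E X \<Longrightarrow> v \<in> C \<Longrightarrow> v \<in> D \<Longrightarrow> C = D"
  by (metis comps_joined)

lemma comps_edge_closed:
  assumes "C \<in> comps V E X" "u \<in> C" "{u, v} \<in> E" "v \<in> V - X"
  shows "v \<in> C"
proof -
  have "(u, v) \<in> joined_within E (V - X)"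
    unfolding joined_within_def using assms comps_subset by (intro r_into_rtrancl) blast
  then show ?thesis using comps_joined[OF assms(1,2)] by blast
qed

lemma comps_joined_within:
  assumes C: "C \<in> comps V E X" and "u \<in> C" "v \<in> C"
  shows "(u, v) \<in> joined_within E C"
proof -
  have "(u, v) \<in> joined_within E (V - X)" using comps_joined[OF assms(1,2)] assms(3) by blast
  then have "(u, v) \<in> joined_within E C \<and> v \<in> C"
    unfolding joined_within_def[of E "V - X"]
  proof (induction rule: rtrancl_induct)
    case base
    then show ?case using assms(2) by (simp add: joined_within_def)
  next
    case (step v w)
    then have "w \<in> C" using comps_edge_closed[OF C, of v w] by blast
    then show ?case using step unfolding joined_within_def by (auto intro: rtrancl_into_rtrancl)
  qed
  then show ?thesis by simp
qed

lemma comp_map_comps: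
  assumes "X \<subseteq> X'" and C': "C' \<in> comps V E X'"
  shows "comp_map V E X C' \<in> comps V E X" and "C' \<subseteq> comp_map V E X C'"
proof -
  obtain u where u: "u \<in> V - X'" "C' = joined_within E (V - X') `` {u}" using C' by (rule compsE)
  let ?C = "joined_within E (V - X) `` {u}"
  have "?C \<in> comps V E X" using u(1) assms(1) by (auto simp: comps_def)
  moreover have "C' \<subseteq> ?C" using joined_within_mono[of "V - X'" "V - X" E] assms(1) u(2) by blast
  moreover have "D = ?C" if "D \<in> comps V E X" "C' \<subseteq> D" for D
    using comps_eq[OF that(1) calculation(1)] comps_nonempty[OF C'] calculation(2) that(2) by blast
  ultimately have "\<exists>!C. C \<in> comps V E X \<and> C' \<subseteq> C" by blast
  then have "comp_map V E X C' \<in> comps V E X \<and> C' \<subseteq> comp_map V E X C'"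
    unfolding comp_map_def by (rule theI')
  then show "comp_map V E X C' \<in> comps V E X" "C' \<subseteq> comp_map V E X C'" by simp_all
qed

lemma Union_comps_disjoint:
  "\<C> \<subseteq> comps V E X \<Longrightarrow> \<D> \<subseteq> comps V E X \<Longrightarrow> \<C> \<inter> \<D> = {} \<Longrightarrow> \<Union>\<C> \<inter> \<Union>\<D> = {}"
  using comps_eq by (fastforce simp: subset_iff)

section \<open>Tangles\<close>

lemma ultrafilters_onD:
  assumes "\<U> \<in> ultrafilters_on S"
  shows "A \<in> \<U> \<Longrightarrow> A \<subseteq> S" and "S \<in> \<U>" and "{} \<notin> \<U>"
    and "A \<in> \<U> \<Longrightarrow> A' \<in> \<U> \<Longrightarrow> A \<inter> A' \<in> \<U>"
    and "A \<in> \<U> \<Longrightarrow> A \<subseteq> A' \<Longrightarrow> A' \<subseteq> S \<Longrightarrow> A' \<in> \<U>"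
    and "A \<subseteq> S \<Longrightarrow> A \<in> \<U> \<or> S - A \<in> \<U>"
  using assms by (auto simp: ultrafilters_on_def)

text \<open>
  Because of this, two tangles agree as soon as one is contained in the other at every \<open>X\<close>.
\<close>

lemma ultrafilters_on_maximal:
  assumes "\<U> \<in> ultrafilters_on S" "\<W> \<in> ultrafilters_on S" "\<U> \<subseteq> \<W>"
  shows "\<U> = \<W>"
proof (rule ccontr)
  assume "\<U> \<noteq> \<W>"
  then obtain A where A: "A \<in> \<W>" "A \<notin> \<U>" using assms(3) by blast
  then have "S - A \<in> \<U>"
    using ultrafilters_onD(1)[OF assms(2)] ultrafilters_onD(6)[OF assms(1)] by blast
  then have "A \<inter> (S - A) \<in> \<W>" using ultrafilters_onD(4)[OF assms(2) A(1)] assms(3) by blast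
  then show False using ultrafilters_onD(3)[OF assms(2)] by simp
qed

lemma ultrafilters_on_split:
  assumes "\<U> \<in> ultrafilters_on S" and "A \<union> A' \<in> \<U>"
  shows "A \<in> \<U> \<or> A' \<in> \<U>"
proof (rule ccontr)
  assume none: "\<not> ?thesis"
  have "A \<union> A' \<subseteq> S" using ultrafilters_onD(1)[OF assms] .
  then have "S - A \<in> \<U>" "S - A' \<in> \<U>" using none ultrafilters_onD(6)[OF assms(1)] by auto
  then have "(A \<union> A') \<inter> (S - A) \<inter> (S - A') \<in> \<U>"
    using ultrafilters_onD(4)[OF assms(1)] assms(2) by blast
  moreover have "(A \<union> A') \<inter> (S - A) \<inter> (S - A') = {}" by blast
  ultimately show False using ultrafilters_onD(3)[OF assms(1)] by simp
qed

context graph_complex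
begin

lemma tangles_ultrafilter:
  "\<tau> \<in> tangles V E \<Longrightarrow> finite X \<Longrightarrow> X \<subseteq> V \<Longrightarrow> \<tau> X \<in> ultrafilters_on (comps V E X)"
  by (auto simp: tangles_def)

lemma tangles_compatible:
  "\<tau> \<in> tangles V E \<Longrightarrow> finite X' \<Longrightarrow> X' \<subseteq> V \<Longrightarrow> X \<subseteq> X' \<Longrightarrow>
    \<tau> X = ultrafilter_image (comp_map V E X) (comps V E X') (comps V E X) (\<tau> X')"
  by (simp add: tangles_def)

lemma tangle_eqI:
  assumes "\<sigma> \<in> tangles V E" "\<tau> \<in> tangles V E"
    and "\<And>X. finite X \<Longrightarrow> X \<subseteq> V \<Longrightarrow> \<sigma> X \<subseteq> \<tau> X"
  shows "\<sigma> = \<tau>"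
proof
  fix X
  show "\<sigma> X = \<tau> X"
  proof (cases "finite X \<and> X \<subseteq> V")
    case True
    then show ?thesis using assms tangles_ultrafilter ultrafilters_on_maximal by metis
  next
    case False
    then show ?thesis
      using assms(1,2) PiE_arb[of \<sigma> _ _ X] PiE_arb[of \<tau> _ _ X]
      unfolding tangles_def by (metis (no_types, lifting) mem_Collect_eq)
  qed
qed

text \<open>
  The vertex sets on which \<open>\<tau>\<close> lives. They form the base of a filter
  (\<open>sides_directed\<close>), which lets limits along \<open>\<tau>\<close> be taken without mentioning the separators \<open>X\<close>.
\<close>

definition sides :: "('a set \<Rightarrow> 'a set set set) \<Rightarrow> 'a set set" where
  "sides \<tau> = {\<Union>\<C> | X \<C>. finite X \<and> X \<subseteq> V \<and> \<C> \<in> \<tau> X}"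

context
  fixes \<tau> assumes \<tau>: "\<tau> \<in> tangles V E"
begin

lemma sides_nonempty: "W \<in> sides \<tau> \<Longrightarrow> W \<noteq> {}"
proof -
  assume "W \<in> sides \<tau>"
  then obtain X \<C> where X: "finite X" "X \<subseteq> V" "\<C> \<in> \<tau> X" "W = \<Union>\<C>" by (auto simp: sides_def)
  note uf = ultrafilters_onD[OF tangles_ultrafilter[OF \<tau> X(1,2)]]
  obtain C where "C \<in> \<C>" using uf(3) X(3) by (cases "\<C> = {}") auto
  moreover have "\<C> \<subseteq> comps V E X" using uf(1)[OF X(3)] .
  ultimately show ?thesis using comps_nonempty X(4) by blast
qed

text \<open>
  In particular no point of \<open>G\<close> lies in all hulls of sides of \<open>\<tau>\<close>: its support is finite.
\<close>

lemma sides_cofinite: "finite X \<Longrightarrow> X \<subseteq> V \<Longrightarrow> V - X \<in> sides \<tau>"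
  unfolding sides_def
  using ultrafilters_onD(2)[OF tangles_ultrafilter[OF \<tau>]] Union_comps by fastforce

lemma sides_directed:
  assumes "W \<in> sides \<tau>" "W' \<in> sides \<tau>"
  shows "\<exists>W''\<in>sides \<tau>. W'' \<subseteq> W \<inter> W'"
proof -
  obtain X \<C> where X: "finite X" "X \<subseteq> V" "\<C> \<in> \<tau> X" "W = \<Union>\<C>" using assms(1) by (auto simp: sides_def)
  obtain X' \<C>' where X': "finite X'" "X' \<subseteq> V" "\<C>' \<in> \<tau> X'" "W' = \<Union>\<C>'" using assms(2) by (auto simp: sides_def)
  let ?Y = "X \<union> X'"
  have Y: "finite ?Y" "?Y \<subseteq> V" using X X' by auto
  note uf = ultrafilters_onD[OF tangles_ultrafilter[OF \<tau> Y]]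
  let ?\<D> = "{C \<in> comps V E ?Y. comp_map V E X C \<in> \<C>}"
  let ?\<D>' = "{C \<in> comps V E ?Y. comp_map V E X' C \<in> \<C>'}"
  have "?\<D> \<in> \<tau> ?Y"
    using X(3) tangles_compatible[OF \<tau> Y, of X] by (auto simp: ultrafilter_image_def)
  moreover have "?\<D>' \<in> \<tau> ?Y"
    using X'(3) tangles_compatible[OF \<tau> Y, of X'] by (auto simp: ultrafilter_image_def)
  ultimately have "?\<D> \<inter> ?\<D>' \<in> \<tau> ?Y" by (rule uf(4))
  then have "\<Union>(?\<D> \<inter> ?\<D>') \<in> sides \<tau>" unfolding sides_def using Y by blast
  moreover have "\<Union>(?\<D> \<inter> ?\<D>') \<subseteq> W \<inter> W'"
    using comp_map_comps(2)[of X ?Y _ V E] comp_map_comps(2)[of X' ?Y _ V E] X(4) X'(4) by fast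
  ultimately show ?thesis by blast
qed

end

lemma edge_boundary_comps:
  assumes "\<C> \<subseteq> comps V E X"
  shows "edge_boundary_within (\<Union>\<C>) X"
  unfolding edge_boundary_within_def
  using comps_edge_closed[where V = V and E = E and X = X] assms edgeD by blast

text \<open>
  An edge with an end in a component of \<open>G - X\<close> either lies inside that component or ends in \<open>X\<close>.
\<close>

lemma tangle_nbhd_eq:
  assumes \<C>: "\<C> \<subseteq> comps V E X"
  shows "tangle_nbhd V E X \<C> = Inl ` open_hull (\<Union>\<C>) \<union> Inr ` {\<tau> \<in> tangles V E. \<C> \<in> \<tau> X}"
proof -
  let ?L = "(\<Union>C\<in>\<C>. complex_points C {e\<in>E. e \<subseteq> C}) \<union> inner_points {e\<in>E. \<exists>x\<in>X. \<exists>y\<in>\<Union>\<C>. e = {x, y}}"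
  have sub: "\<Union>\<C> \<subseteq> V" using \<C> comps_subset by blast
  have "?L \<subseteq> open_hull (\<Union>\<C>)"
  proof
    fix z assume "z \<in> ?L"
    then consider (vertex) C v where "C \<in> \<C>" "v \<in> C" "z = vertex_point v"
      | (inner) x y t where "{x, y} \<in> E" "0 < t" "t < 1" "z = edge_point x y t" "x \<in> \<Union>\<C> \<or> y \<in> \<Union>\<C>"
      unfolding complex_points_def inner_points_def by (force simp: doubleton_eq_iff)
    then show "z \<in> open_hull (\<Union>\<C>)"
    proof cases
      case vertex
      then show ?thesis using vertex_point_in_open_hull[of v] sub by auto
    next
      case inner
      then show ?thesis
        using inner_point_in_complex[OF inner(1-3)] supp_edge_point[OF edgeD(3)[OF inner(1)] inner(2,3)]
        by (auto simp: open_hull_def)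
    qed
  qed
  moreover have "open_hull (\<Union>\<C>) \<subseteq> ?L"
  proof
    fix z assume z: "z \<in> open_hull (\<Union>\<C>)"
    then have "z \<in> complex_points V E" by (simp add: open_hull_def)
    then show "z \<in> ?L"
    proof (cases z rule: complex_point_cases)
      case (vertex v)
      then have "v \<in> \<Union>\<C>" using z vertex_point_in_open_hull by blast
      then show ?thesis unfolding complex_points_def using vertex(2) by blast
    next
      case (inner x y t)
      have mem: "z \<in> ?L" if ab: "a \<in> C" "C \<in> \<C>" "{a, b} \<in> E" "0 < s" "s < 1" "z = edge_point a b s" for a b s C
      proof -
        have "b \<in> C \<or> b \<in> X"
          using comps_edge_closed[of C V E X a b] \<C> ab edgeD[OF ab(3)] by blast
        then show ?thesis
        proof
          assume "b \<in> C"
          then have "z \<in> inner_points {e \<in> E. e \<subseteq> C}" unfolding inner_points_def using ab by auto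
          then show ?thesis unfolding complex_points_def using ab(2) by blast
        next
          assume "b \<in> X"
          then have "{a, b} \<in> {e\<in>E. \<exists>x\<in>X. \<exists>y\<in>\<Union>\<C>. e = {x, y}}" using ab by (auto simp: insert_commute)
          then show ?thesis unfolding inner_points_def using ab by blast
        qed
      qed
      have "supp z = {x, y}" using inner supp_edge_point edgeD(3) by metis
      then consider C where "x \<in> C" "C \<in> \<C>" | C where "y \<in> C" "C \<in> \<C>"
        using z unfolding open_hull_def by auto
      then show ?thesis
      proof cases
        case 1
        then show ?thesis using mem[of x _ y t] inner by blast
      next
        case 2
        have "{y, x} \<in> E" "0 < 1 - t" "1 - t < 1" "z = edge_point y x (1 - t)"
          using inner edge_point_flip[of y x t] by (auto simp: insert_commute)
        then show ?thesis using mem 2 by blast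
      qed
    qed
  qed
  ultimately have "?L = open_hull (\<Union>\<C>)" by (rule subset_antisym)
  then show ?thesis unfolding tangle_nbhd_def by (simp only:)
qed


section \<open>The tangle of a point of the remainder\<close>

definition tangle_at :: "((('a \<Rightarrow> real) \<Rightarrow> real) \<Rightarrow> real) \<Rightarrow> 'a set \<Rightarrow> 'a set set set" where
  "tangle_at p = (\<lambda>X\<in>{X. finite X \<and> X \<subseteq> V}. {\<C>. \<C> \<subseteq> comps V E X \<and> p \<in> cl (open_hull (\<Union>\<C>))})"

lemma in_tangle_at:
  "finite X \<Longrightarrow> X \<subseteq> V \<Longrightarrow> \<C> \<in> tangle_at p X \<longleftrightarrow> \<C> \<subseteq> comps V E X \<and> p \<in> cl (open_hull (\<Union>\<C>))"
  by (simp add: tangle_at_def)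

lemma Union_comps_avoid: "\<C> \<subseteq> comps V E X \<Longrightarrow> \<Union>\<C> \<inter> X = {}"
  using comps_subset by blast

lemma tangle_at_disjoint:
  assumes "p \<in> R" "finite X" "\<C> \<subseteq> comps V E X" "\<D> \<subseteq> comps V E X" "\<C> \<inter> \<D> = {}"
    and "p \<in> cl (open_hull (\<Union>\<C>))"
  shows "p \<notin> cl (open_hull (\<Union>\<D>))"
  by (rule cl_disjoint_on_remainder[OF assms(2) edge_boundary_comps[OF assms(3)]
      Union_comps_disjoint[OF assms(3-5)] Union_comps_avoid[OF assms(4)] assms(1,6)])

lemma tangle_at_cover:
  assumes "p \<in> R" "finite X" "\<C> \<subseteq> comps V E X"
  shows "p \<in> cl (open_hull (\<Union>\<C>)) \<or> p \<in> cl (open_hull (\<Union>(comps V E X - \<C>)))"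
proof -
  have "\<Union>\<C> \<union> \<Union>(comps V E X - \<C>) = V - X"
    using assms(3) by (simp flip: Union_Un_distrib add: Un_absorb1 Union_comps)
  then have "V \<subseteq> (\<Union>\<C> \<union> \<Union>(comps V E X - \<C>)) \<union> X" by auto
  from remainder_subset_cl_cofinite_hull[OF assms(2) this assms(1)] show ?thesis
    by (simp only: open_hull_Un sc_closure_Un Un_iff)
qed

text \<open>
  Since the right-hand side is an open condition on \<open>p\<close> and the left-hand side a closed one, both are clopen on
  the remainder.
\<close>

lemma tangle_at_iff_complement:
  assumes "p \<in> R" "finite X" "\<C> \<subseteq> comps V E X"
  shows "p \<in> cl (open_hull (\<Union>\<C>)) \<longleftrightarrow> p \<notin> cl (open_hull (\<Union>(comps V E X - \<C>)))"
  using tangle_at_cover[OF assms] tangle_at_disjoint[OF assms(1-3), of "comps V E X - \<C>"] by blast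

lemma tangle_at_ultrafilter:
  assumes p: "p \<in> R" and X: "finite X" "X \<subseteq> V"
  shows "tangle_at p X \<in> ultrafilters_on (comps V E X)"
proof -
  have top: "comps V E X \<in> tangle_at p X"
    unfolding in_tangle_at[OF X] using tangle_at_cover[OF p X(1), of "{}"] by simp
  have bot: "{} \<notin> tangle_at p X" by (simp add: in_tangle_at[OF X])
  have up: "\<D> \<in> tangle_at p X" if "\<C> \<in> tangle_at p X" "\<C> \<subseteq> \<D>" "\<D> \<subseteq> comps V E X" for \<C> \<D>
    using that subsetD[OF sc_closure_mono[OF open_hull_mono[OF Union_mono[OF that(2)]], of K]]
    unfolding in_tangle_at[OF X] by blast
  have meet: "\<C> \<inter> \<D> \<in> tangle_at p X" if "\<C> \<in> tangle_at p X" "\<D> \<in> tangle_at p X" for \<C> \<D>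
  proof -
    have C: "\<C> \<subseteq> comps V E X" "p \<in> cl (open_hull (\<Union>\<C>))" and D: "\<D> \<subseteq> comps V E X" "p \<in> cl (open_hull (\<Union>\<D>))"
      using that unfolding in_tangle_at[OF X] by auto
    have "\<Union>\<C> = \<Union>(\<C> \<inter> \<D>) \<union> \<Union>(\<C> - \<D>)" by blast
    then have "p \<in> cl (open_hull (\<Union>(\<C> \<inter> \<D>))) \<union> cl (open_hull (\<Union>(\<C> - \<D>)))"
      using C(2) by (simp only: open_hull_Un sc_closure_Un)
    moreover have "p \<notin> cl (open_hull (\<Union>(\<C> - \<D>)))"
      by (rule tangle_at_disjoint[OF p X(1) D(1) _ _ D(2)]) (use C in auto)
    ultimately show ?thesis unfolding in_tangle_at[OF X] using C(1) by blast
  qed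
  have split: "\<C> \<in> tangle_at p X \<or> comps V E X - \<C> \<in> tangle_at p X" if "\<C> \<subseteq> comps V E X" for \<C>
    using tangle_at_cover[OF p X(1) that] that unfolding in_tangle_at[OF X] by blast
  have "tangle_at p X \<subseteq> Pow (comps V E X)" unfolding tangle_at_def using X by auto
  with top bot up meet split show ?thesis unfolding ultrafilters_on_def by simp
qed

text \<open>
  Compatibility in one direction is monotonicity: the components of \<open>G - X'\<close> that are mapped into
  \<open>\<C>\<close> have their union inside \<open>\<Union>\<C>\<close>. The other direction follows by passing to complements.
\<close>

lemma tangle_at_in_tangles:
  assumes p: "p \<in> R"
  shows "tangle_at p \<in> tangles V E"
proof -
  have "tangle_at p X = ultrafilter_image (comp_map V E X) (comps V E X') (comps V E X) (tangle_at p X')"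
    if X': "finite X'" "X' \<subseteq> V" and XX': "X \<subseteq> X'" for X X'
  proof -
    have X: "finite X" "X \<subseteq> V" using X' XX' finite_subset by auto
    have lift: "\<C> \<in> tangle_at p X"
      if C: "\<C> \<subseteq> comps V E X" "{C \<in> comps V E X'. comp_map V E X C \<in> \<C>} \<in> tangle_at p X'" for \<C>
    proof -
      have "\<Union>{C \<in> comps V E X'. comp_map V E X C \<in> \<C>} \<subseteq> \<Union>\<C>"
        using comp_map_comps(2)[OF XX'] by fast
      from subsetD[OF sc_closure_mono[OF open_hull_mono[OF this], of K]] show ?thesis
        using C unfolding in_tangle_at[OF X] in_tangle_at[OF X'] by blast
    qed
    show ?thesis
    proof (intro set_eqI iffI)
      fix \<C> assume "\<C> \<in> ultrafilter_image (comp_map V E X) (comps V E X') (comps V E X) (tangle_at p X')"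
      then show "\<C> \<in> tangle_at p X" using lift unfolding ultrafilter_image_def by blast
    next
      fix \<C> assume C: "\<C> \<in> tangle_at p X"
      then have sub: "\<C> \<subseteq> comps V E X" by (simp add: in_tangle_at[OF X])
      let ?pre = "\<lambda>\<C>. {C \<in> comps V E X'. comp_map V E X C \<in> \<C>}"
      have "?pre (comps V E X - \<C>) \<notin> tangle_at p X'"
      proof
        assume "?pre (comps V E X - \<C>) \<in> tangle_at p X'"
        then have "comps V E X - \<C> \<in> tangle_at p X" using lift by blast
        then show False
          using C tangle_at_iff_complement[OF p X(1) sub] by (simp add: in_tangle_at[OF X])
      qed
      moreover have "?pre (comps V E X - \<C>) = comps V E X' - ?pre \<C>"
        using comp_map_comps(1)[OF XX'] by blast
      ultimately have "?pre \<C> \<in> tangle_at p X'"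
        using ultrafilters_onD(6)[OF tangle_at_ultrafilter[OF p X'], of "?pre \<C>"] by auto
      then show "\<C> \<in> ultrafilter_image (comp_map V E X) (comps V E X') (comps V E X) (tangle_at p X')"
        using sub by (simp add: ultrafilter_image_def)
    qed
  qed
  moreover have "tangle_at p \<in> (\<Pi>\<^sub>E X\<in>{X. finite X \<and> X \<subseteq> V}. ultrafilters_on (comps V E X))"
    using tangle_at_ultrafilter[OF p] by (auto simp: tangle_at_def)
  ultimately show ?thesis unfolding tangles_def by blast
qed

lemma tangle_at_eqI:
  assumes "p \<in> R" "\<tau> \<in> tangles V E" and "\<And>W. W \<in> sides \<tau> \<Longrightarrow> p \<in> cl (open_hull W)"
  shows "tangle_at p = \<tau>"
proof (rule sym, rule tangle_eqI[OF assms(2) tangle_at_in_tangles[OF assms(1)]])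
  fix X assume X: "finite X" "X \<subseteq> V"
  show "\<tau> X \<subseteq> tangle_at p X"
  proof
    fix \<C> assume C: "\<C> \<in> \<tau> X"
    then have "\<Union>\<C> \<in> sides \<tau>" unfolding sides_def using X by blast
    then show "\<C> \<in> tangle_at p X"
      using assms(3) ultrafilters_onD(1)[OF tangles_ultrafilter[OF assms(2) X] C]
      by (simp add: in_tangle_at[OF X])
  qed
qed

text \<open>
  The rest of \<open>D\<close> lies in \<open>G[X]\<close> and in the hull of the complementary components, and \<open>p\<close> is a limit
  of neither.
\<close>

lemma in_cl_Int_open_hull:
  assumes p: "p \<in> R" "p \<in> cl D" and D: "D \<subseteq> complex_points V E"
    and X: "finite X" "X \<subseteq> V" "\<C> \<in> tangle_at p X"
  shows "p \<in> cl (D \<inter> open_hull (\<Union>\<C>))"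
proof -
  let ?\<D> = "comps V E X - \<C>"
  have C: "\<C> \<subseteq> comps V E X" "p \<in> cl (open_hull (\<Union>\<C>))" using X by (auto simp: in_tangle_at)
  have "\<Union>\<C> \<union> \<Union>?\<D> = V - X"
    using C(1) by (simp flip: Union_Un_distrib add: Un_absorb1 Union_comps)
  then have "topspace K = open_hull (\<Union>\<C> \<union> \<Union>?\<D>) \<union> full_subcomplex X"
    by (intro complex_eq_Un) auto
  then have "D \<subseteq> (D \<inter> open_hull (\<Union>\<C>)) \<union> open_hull (\<Union>?\<D>) \<union> full_subcomplex X"
    using D unfolding topspace_complex open_hull_Un by blast
  then have "p \<in> cl (D \<inter> open_hull (\<Union>\<C>)) \<union> cl (open_hull (\<Union>?\<D>)) \<union> cl (full_subcomplex X)"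
    using p(2) subsetD[OF sc_closure_mono[of D _ K]] by (simp only: sc_closure_Un[symmetric])
  moreover have "p \<notin> cl (open_hull (\<Union>?\<D>))"
    using tangle_at_iff_complement[OF p(1) X(1) C(1)] C(2) by blast
  moreover have "p \<notin> cl (full_subcomplex X)"
    using sc_closure_compact[OF compactin_full_subcomplex[OF X(1)]] p(1)
      compactin_subset_topspace[OF compactin_full_subcomplex[OF X(1)]]
    by (auto simp: remainder_iff)
  ultimately show ?thesis by blast
qed

text \<open>
  By compactness some \<open>p\<close> in \<open>Z\<close> is a limit of all the sets \<open>D \<inter> open_hull W\<close>. It cannot be a
  point \<open>z\<close> of \<open>G\<close>: these sets are closed in \<open>G\<close>, and the one for \<open>W = V - supp z\<close> does not contain
  \<open>z\<close>. Discreteness of \<open>D\<close> is what excludes the vertices of \<open>G\<close> that are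
  limits of all hulls of sides of \<open>\<tau>\<close>. The closed set \<open>Z\<close> serves to keep \<open>p\<close> outside a given open set.
\<close>

lemma limit_of_discrete_set:
  assumes D: "D \<subseteq> complex_points V E" "inj_on supp D" and Z: "closedin B Z"
    and \<tau>: "\<tau> \<in> tangles V E" and meet: "\<And>W. W \<in> sides \<tau> \<Longrightarrow> Z \<inter> cl (D \<inter> open_hull W) \<noteq> {}"
  shows "\<exists>p\<in>Z \<inter> R. p \<in> cl D \<and> tangle_at p = \<tau>"
proof -
  let ?\<K> = "(\<lambda>W. Z \<inter> cl (D \<inter> open_hull W)) ` sides \<tau>"
  have V: "V \<in> sides \<tau>" using sides_cofinite[OF \<tau>, of "{}"] by simp
  have mono: "Z \<inter> cl (D \<inter> open_hull W) \<subseteq> Z \<inter> cl (D \<inter> open_hull W')" if "W \<subseteq> W'" for W W'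
    using sc_closure_mono[of "D \<inter> open_hull W" "D \<inter> open_hull W'" K] open_hull_mono[OF that] by blast
  have "\<Inter>?\<K> \<noteq> {}"
  proof
    assume empty: "\<Inter>?\<K> = {}"
    have "\<exists>C\<in>?\<K>. C \<subseteq> {}"
    proof (rule compact_space_directed_closed[OF compact_space_stone_cech])
      show "?\<K> \<noteq> {}" using V by blast
      show "closedin B C" if "C \<in> ?\<K>" for C
        using that Z closedin_sc_closure[of K] by blast
      show "\<exists>M\<in>?\<K>. M \<subseteq> C \<inter> C'" if CC': "C \<in> ?\<K>" "C' \<in> ?\<K>" for C C'
      proof -
        obtain W W' where W: "W \<in> sides \<tau>" "C = Z \<inter> cl (D \<inter> open_hull W)"
          and W': "W' \<in> sides \<tau>" "C' = Z \<inter> cl (D \<inter> open_hull W')" using CC' by blast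
        obtain W'' where W'': "W'' \<in> sides \<tau>" "W'' \<subseteq> W \<inter> W'" using sides_directed[OF \<tau> W(1) W'(1)] by blast
        then have "Z \<inter> cl (D \<inter> open_hull W'') \<subseteq> C \<inter> C'"
          using mono[of W'' W] mono[of W'' W'] W(2) W'(2) by blast
        then show ?thesis using W''(1) by blast
      qed
    qed (use empty in simp_all)
    then show False using meet by blast
  qed
  then obtain p where p: "\<And>W. W \<in> sides \<tau> \<Longrightarrow> p \<in> Z \<inter> cl (D \<inter> open_hull W)" by blast
  have pB: "p \<in> topspace B" using p[OF V] closedin_subset[OF Z] by blast
  have "p \<notin> \<iota> ` topspace K"
  proof
    assume "p \<in> \<iota> ` topspace K"
    then obtain z where z: "z \<in> topspace K" "p = \<iota> z" by blast
    have fin: "finite (supp z)" "supp z \<subseteq> V"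
      using supp_complex_point z(1) topspace_complex by blast+
    have "closedin K (D \<inter> open_hull (V - supp z))"
      using D by (intro closedin_inj_on_supp) (auto intro: inj_on_subset)
    moreover have "\<iota> z \<in> cl (D \<inter> open_hull (V - supp z))"
      using p[OF sides_cofinite[OF \<tau> fin]] z(2) by blast
    ultimately have "z \<in> open_hull (V - supp z)"
      using sc_closure_trace[OF completely_regular_complex _ z(1)] by blast
    then show False by (auto simp: open_hull_def)
  qed
  then have pR: "p \<in> R" using pB by (simp add: remainder_iff)
  have "p \<in> cl (open_hull W)" if "W \<in> sides \<tau>" for W
    using p[OF that] sc_closure_mono[of "D \<inter> open_hull W" "open_hull W" K] by blast
  then have "tangle_at p = \<tau>" using tangle_at_eqI[OF pR \<tau>] by blast
  moreover have "p \<in> cl D" using p[OF V] sc_closure_mono[of "D \<inter> open_hull V" D K] by blast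
  ultimately show ?thesis using p[OF V] pR by blast
qed

lemma vertex_points_discrete:
  "vertex_point ` V \<subseteq> complex_points V E" "inj_on supp (vertex_point ` V)"
  by (auto simp: inj_on_def vertex_point_in_complex)

lemma sides_subset:
  assumes \<tau>: "\<tau> \<in> tangles V E" and "W \<in> sides \<tau>"
  shows "W \<subseteq> V"
proof -
  obtain X \<C> where X: "finite X" "X \<subseteq> V" "\<C> \<in> \<tau> X" "W = \<Union>\<C>"
    using assms(2) by (auto simp: sides_def)
  then have "\<C> \<subseteq> comps V E X" using ultrafilters_onD(1)[OF tangles_ultrafilter[OF \<tau>]] by blast
  then show ?thesis using X(4) comps_subset by blast
qed

text \<open>
  The limit can even be taken along vertices. The quotient property needs this: a limit of points of
  the remainder may lie in \<open>G\<close>, but not if these points are themselves limits of vertices.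
\<close>

lemma tangle_at_surj_on_vertex_limits:
  assumes \<tau>: "\<tau> \<in> tangles V E"
  shows "\<exists>p\<in>R. p \<in> cl (vertex_point ` V) \<and> tangle_at p = \<tau>"
proof -
  have "\<exists>p\<in>topspace B \<inter> R. p \<in> cl (vertex_point ` V) \<and> tangle_at p = \<tau>"
  proof (rule limit_of_discrete_set[OF vertex_points_discrete closedin_topspace \<tau>])
    fix W assume W: "W \<in> sides \<tau>"
    obtain v where v: "v \<in> W" using sides_nonempty[OF \<tau> W] by blast
    then have "v \<in> V" using sides_subset[OF \<tau> W] by blast
    then have mem: "vertex_point v \<in> vertex_point ` V \<inter> open_hull W"
      using v vertex_point_in_open_hull by blast
    have "vertex_point ` V \<inter> open_hull W \<subseteq> topspace K" using open_hull_subset by blast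
    from subset_sc_closure[OF this] mem
    have "\<iota> (vertex_point v) \<in> cl (vertex_point ` V \<inter> open_hull W)" by blast
    then show "topspace B \<inter> cl (vertex_point ` V \<inter> open_hull W) \<noteq> {}"
      using sc_closure_subset by blast
  qed
  then show ?thesis by blast
qed

text \<open>
  Otherwise the points of \<open>G\<close> outside \<open>U\<close> meet every hull of a side of \<open>\<tau>\<close>. Thinning them out to one
  point per support does not change which hulls they meet, and then they have a limit in the fibre over
  \<open>\<tau>\<close> but outside \<open>U\<close>.
\<close>

lemma open_contains_hull:
  assumes U: "openin B U" and \<tau>: "\<tau> \<in> tangles V E" and fiber: "\<And>p. p \<in> R \<Longrightarrow> tangle_at p = \<tau> \<Longrightarrow> p \<in> U"
  shows "\<exists>W\<in>sides \<tau>. \<iota> ` open_hull W \<subseteq> U"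
proof (rule ccontr)
  assume none: "\<not> ?thesis"
  let ?Y = "{z \<in> complex_points V E. \<iota> z \<notin> U}"
  define rep where "rep = (\<lambda>S. SOME z. z \<in> ?Y \<and> supp z = S)"
  have rep: "rep (supp z) \<in> ?Y \<and> supp (rep (supp z)) = supp z" if "z \<in> ?Y" for z
    unfolding rep_def by (rule someI2[of _ z]) (use that in simp_all)
  let ?D = "rep ` supp ` ?Y"
  have D: "?D \<subseteq> ?Y" using rep by blast
  have "\<exists>p\<in>(topspace B - U) \<inter> R. p \<in> cl ?D \<and> tangle_at p = \<tau>"
  proof (rule limit_of_discrete_set[OF _ _ _ \<tau>])
    show "?D \<subseteq> complex_points V E" using D by blast
    show "inj_on supp ?D" using rep by (fastforce simp: inj_on_def)
    show "closedin B (topspace B - U)" using U by blast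
    fix W assume "W \<in> sides \<tau>"
    then obtain z where z: "z \<in> open_hull W" "\<iota> z \<notin> U" using none by blast
    then have zY: "z \<in> ?Y" by (simp add: open_hull_def)
    let ?z = "rep (supp z)"
    have "?z \<in> ?D \<inter> open_hull W"
      using rep[OF zY] zY z(1) by (auto simp: open_hull_def)
    moreover have sub: "?D \<inter> open_hull W \<subseteq> topspace K" using open_hull_subset by blast
    ultimately have "\<iota> ?z \<in> cl (?D \<inter> open_hull W)" using subset_sc_closure[OF sub] by blast
    moreover have "\<iota> ?z \<in> topspace B - U"
      using calculation sc_closure_subset rep[OF zY] by blast
    ultimately show "(topspace B - U) \<inter> cl (?D \<inter> open_hull W) \<noteq> {}" by blast
  qed
  then show False using fiber by blast
qed

text \<open>
  Every tangle close to \<open>\<tau>\<close> is the tangle of some limit of vertices near \<open>\<tau>\<close>, so this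
  says that \<open>U\<close> meets all fibres over a neighbourhood of \<open>\<tau>\<close>.
\<close>

lemma open_contains_vertex_limits:
  assumes U: "openin B U" and \<tau>: "\<tau> \<in> tangles V E" and fiber: "\<And>p. p \<in> R \<Longrightarrow> tangle_at p = \<tau> \<Longrightarrow> p \<in> U"
  shows "\<exists>W\<in>sides \<tau>. R \<inter> cl (vertex_point ` V \<inter> open_hull W) \<subseteq> U"
proof (rule ccontr)
  assume none: "\<not> ?thesis"
  have "\<exists>p\<in>(topspace B - U) \<inter> R. p \<in> cl (vertex_point ` V) \<and> tangle_at p = \<tau>"
  proof (rule limit_of_discrete_set[OF vertex_points_discrete _ \<tau>])
    show "closedin B (topspace B - U)" using U by blast
    fix W assume "W \<in> sides \<tau>"
    then obtain p where "p \<in> cl (vertex_point ` V \<inter> open_hull W)" "p \<notin> U" using none by blast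
    then show "(topspace B - U) \<inter> cl (vertex_point ` V \<inter> open_hull W) \<noteq> {}"
      using sc_closure_subset by blast
  qed
  then show False using fiber by blast
qed


section \<open>The fibres are the components of the remainder\<close>

lemma closure_of_open_disjoint:
  "openin X U \<Longrightarrow> U \<inter> S = {} \<Longrightarrow> U \<inter> X closure_of S = {}"
  by (auto simp: openin_Int_closure_of_eq_empty)

text \<open>
  One star has to serve both points: the continuum that joins two points of a fibre below is built from
  a single choice of stars.
\<close>

lemma small_open_star:
  assumes v: "v \<in> V" and "p \<in> R" "q \<in> R"
  shows "\<exists>r. (\<forall>w. {v, w} \<in> E \<longrightarrow> 0 < r w \<and> r w < 1) \<and>
    p \<notin> cl (open_star E v r) \<and> q \<notin> cl (open_star E v r)"
proof -
  have vK: "vertex_point v \<in> topspace K" using v by (simp add: topspace_complex vertex_point_in_complex)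
  have sep: "\<exists>N N'. openin B N \<and> openin B N' \<and> \<iota> (vertex_point v) \<in> N \<and> s \<in> N' \<and> disjnt N N'" if "s \<in> R" for s
    using Hausdorff_space_stone_cech[of K] that sc_embed_in_stone_cech[OF vK] vK
    unfolding Hausdorff_space_def remainder_iff by blast
  obtain N N' where N: "openin B N" "openin B N'" "\<iota> (vertex_point v) \<in> N" "p \<in> N'" "disjnt N N'"
    using sep[OF assms(2)] by blast
  obtain M M' where M: "openin B M" "openin B M'" "\<iota> (vertex_point v) \<in> M" "q \<in> M'" "disjnt M M'"
    using sep[OF assms(3)] by blast
  let ?U = "{z \<in> topspace K. \<iota> z \<in> N \<inter> M}"
  have "openin K ?U"
    using openin_continuous_map_preimage[OF continuous_map_sc_embed openin_Int[OF N(1) M(1)]] .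
  moreover have "vertex_point v \<in> ?U" using vK N M by blast
  ultimately obtain r where r: "\<And>w. {v, w} \<in> E \<Longrightarrow> 0 < r w \<and> r w < 1" "open_star E v r \<subseteq> ?U"
    using open_star_subset_open v by meson
  have "N' \<inter> \<iota> ` open_star E v r = {}" "M' \<inter> \<iota> ` open_star E v r = {}"
    using r(2) N(5) M(5) unfolding disjnt_def by blast+
  then have "N' \<inter> cl (open_star E v r) = {}" "M' \<inter> cl (open_star E v r) = {}"
    unfolding sc_closure_def by (auto intro!: closure_of_open_disjoint N M)
  then show ?thesis using r(1) N(4) M(4) by blast
qed

lemma sc_closure_UN:
  "finite I \<Longrightarrow> sc_closure X (\<Union>i\<in>I. S i) = (\<Union>i\<in>I. sc_closure X (S i))"
  by (induction I rule: finite_induct) (simp_all add: sc_closure_Un)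

lemma supp_open_star:
  assumes "\<And>w. {v, w} \<in> E \<Longrightarrow> 0 < r w \<and> r w < 1" and "z \<in> open_star E v r"
  shows "v \<in> supp z"
proof -
  consider "z = vertex_point v" | w t where "{v, w} \<in> E" "0 \<le> t" "t < r w" "z = edge_point v w t"
    using assms(2) by (auto simp: open_star_def)
  then show ?thesis
  proof cases
    case 2
    then have "t \<in> {0..1}" "t \<noteq> 1" using assms(1)[of w] by auto
    then show ?thesis using supp_edge_point_closed[OF edgeD(3)[OF 2(1)], of t] 2(4) by auto
  qed simp
qed

context
  fixes \<tau> :: "'a set \<Rightarrow> 'a set set set" and r :: "'a \<Rightarrow> 'a \<Rightarrow> real"
  assumes \<tau>: "\<tau> \<in> tangles V E"
    and star_radii: "star_radii r"
begin

text \<open>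
  No edge joins two components of \<open>G - X\<close>, so no star around a vertex of another component of \<open>\<C>\<close>
  meets the hull of a component \<open>C\<close>.
\<close>

lemma trimmed_hull_Union:
  assumes \<C>: "\<C> \<subseteq> comps V E X"
  shows "trimmed_hull r (\<Union>\<C>) = (\<Union>C\<in>\<C>. trimmed_hull r C)"
proof
  show "(\<Union>C\<in>\<C>. trimmed_hull r C) \<subseteq> trimmed_hull r (\<Union>\<C>)"
    by (intro UN_least trimmed_hull_mono) blast
  show "trimmed_hull r (\<Union>\<C>) \<subseteq> (\<Union>C\<in>\<C>. trimmed_hull r C)"
  proof
    fix z assume z: "z \<in> trimmed_hull r (\<Union>\<C>)"
    then obtain C where C: "C \<in> \<C>" "z \<in> open_hull C"
      by (auto simp: trimmed_hull_def open_hull_def)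
    have "z \<notin> open_star E v (r v)" if v: "v \<in> V - C" for v
    proof
      assume zv: "z \<in> open_star E v (r v)"
      then have "v \<in> \<Union>\<C>" using z v unfolding trimmed_hull_def by blast
      then obtain C' where C': "C' \<in> \<C>" "v \<in> C'" by blast
      have "v \<in> supp z" using supp_open_star[OF star_radiiD[OF star_radii] zv] .
      then have "z \<in> open_hull C'" using C'(2) C(2) by (auto simp: open_hull_def)
      moreover have "open_hull (\<Union>{C}) \<inter> open_hull (\<Union>{C'}) = {}"
      proof (rule open_hull_disjoint)
        show "edge_boundary_within (\<Union>{C}) X" using C(1) \<C> by (intro edge_boundary_comps) blast
        show "\<Union>{C} \<inter> \<Union>{C'} = {}"
          using C(1) C' v \<C> by (intro Union_comps_disjoint[of _ V E X]) auto
        show "\<Union>{C'} \<inter> X = {}" using C'(1) \<C> by (intro Union_comps_avoid) blast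
      qed
      ultimately show False using C(2) by auto
    qed
    then show "z \<in> (\<Union>C\<in>\<C>. trimmed_hull r C)" using C by (auto simp: trimmed_hull_def)
  qed
qed

text \<open>
  A compact connected part of the fibre over \<open>\<tau>\<close>. The shorter the stars, the more of
  the fibre it contains, and every point of the fibre belongs to it for suitable radii.
\<close>

definition tangle_continuum :: "((('a \<Rightarrow> real) \<Rightarrow> real) \<Rightarrow> real) set" where
  "tangle_continuum = (\<Inter>W\<in>sides \<tau>. cl (trimmed_hull r W))"

lemma V_in_sides: "V \<in> sides \<tau>"
  using sides_cofinite[OF \<tau>, of "{}"] by simp

lemma closedin_tangle_continuum: "closedin B tangle_continuum"
  unfolding tangle_continuum_def using V_in_sides by (intro closedin_INT closedin_sc_closure) blast

text \<open>
  This is where trimming matters: a vertex may be a limit of all the untrimmed hulls, but the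
  trimmed ones are closed in \<open>G\<close> and have no point in common.
\<close>

lemma tangle_continuum_subset_remainder: "tangle_continuum \<subseteq> R"
proof
  fix p assume p: "p \<in> tangle_continuum"
  have "p \<notin> \<iota> ` topspace K"
  proof
    assume "p \<in> \<iota> ` topspace K"
    then obtain z where z: "z \<in> topspace K" "p = \<iota> z" by blast
    have fin: "finite (supp z)" "supp z \<subseteq> V"
      using supp_complex_point z(1) topspace_complex by blast+
    have "\<iota> z \<in> cl (trimmed_hull r (V - supp z))"
      using p sides_cofinite[OF \<tau> fin] z(2) unfolding tangle_continuum_def by blast
    then have "z \<in> trimmed_hull r (V - supp z)"
      by (rule sc_closure_trace[OF completely_regular_complex closedin_trimmed_hull[OF star_radii] z(1)])
    then show False by (auto simp: trimmed_hull_def open_hull_def)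
  qed
  then show "p \<in> R" using p closedin_subset[OF closedin_tangle_continuum] by (auto simp: remainder_iff)
qed

text \<open>
  Only the stars around the finitely many vertices of \<open>X\<close> meet the hull of \<open>\<Union>\<C>\<close>, so the part that is
  trimmed away lies in a finite union of stars of which \<open>p\<close> is no limit.
\<close>

lemma in_tangle_continuumI:
  assumes p: "p \<in> R" "tangle_at p = \<tau>" and star: "\<And>v. v \<in> V \<Longrightarrow> p \<notin> cl (open_star E v (r v))"
  shows "p \<in> tangle_continuum"
  unfolding tangle_continuum_def
proof
  fix W assume "W \<in> sides \<tau>"
  then obtain X \<C> where X: "finite X" "X \<subseteq> V" "\<C> \<in> \<tau> X" "W = \<Union>\<C>" by (auto simp: sides_def)
  have C: "\<C> \<subseteq> comps V E X" "p \<in> cl (open_hull W)"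
    using X p(2) in_tangle_at[OF X(1,2), of \<C> p] by auto
  have "open_hull W \<subseteq> trimmed_hull r W \<union> (\<Union>v\<in>X. open_star E v (r v))"
  proof
    fix z assume z: "z \<in> open_hull W"
    show "z \<in> trimmed_hull r W \<union> (\<Union>v\<in>X. open_star E v (r v))"
    proof (cases "z \<in> trimmed_hull r W")
      case False
      then obtain v where v: "v \<in> V - W" "z \<in> open_star E v (r v)"
        using z by (auto simp: trimmed_hull_def)
      then have "z \<in> open_hull {v}" using supp_open_star[OF star_radiiD[OF star_radii] v(2)] z by (auto simp: open_hull_def)
      then have "open_hull W \<inter> open_hull {v} \<noteq> {}" using z by blast
      then have "v \<in> X"
        using open_hull_disjoint[OF edge_boundary_comps[OF C(1)], of "{v}"] v(1) X(4) by auto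
      then show ?thesis using v(2) by blast
    qed simp
  qed
  from subsetD[OF sc_closure_mono[OF this] C(2)]
  have "p \<in> cl (trimmed_hull r W) \<union> (\<Union>v\<in>X. cl (open_star E v (r v)))"
    by (simp only: sc_closure_Un sc_closure_UN[OF X(1)])
  then show "p \<in> cl (trimmed_hull r W)" using star X(2) by blast
qed

text \<open>
  By compactness already the trimmed hull of some side \<open>\<Union>\<C>\<close> lies in \<open>M \<union> M'\<close>. Each component in
  \<open>\<C>\<close> has a connected trimmed hull, which falls into \<open>M\<close> or into \<open>M'\<close>. The ultrafilter contains one of
  the two resulting subsets of \<open>\<C>\<close>, and its union is a smaller side, which confines the continuum to
  one of \<open>M\<close> and \<open>M'\<close>.
\<close>

lemma tangle_continuum_not_split:
  assumes M: "openin B M" "openin B M'" "M \<inter> M' = {}" "tangle_continuum \<subseteq> M \<union> M'"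
  shows "tangle_continuum \<inter> M = {} \<or> tangle_continuum \<inter> M' = {}"
proof -
  have "\<exists>C\<in>(\<lambda>W. cl (trimmed_hull r W)) ` sides \<tau>. C \<subseteq> M \<union> M'"
  proof (rule compact_space_directed_closed[OF compact_space_stone_cech])
    show "(\<lambda>W. cl (trimmed_hull r W)) ` sides \<tau> \<noteq> {}" using V_in_sides by blast
    show "closedin B C" if "C \<in> (\<lambda>W. cl (trimmed_hull r W)) ` sides \<tau>" for C
      using that closedin_sc_closure[of K] by blast
    show "openin B (M \<union> M')" using M by blast
    show "\<Inter>((\<lambda>W. cl (trimmed_hull r W)) ` sides \<tau>) \<subseteq> M \<union> M'" using M(4) by (simp add: tangle_continuum_def)
    fix C C' assume "C \<in> (\<lambda>W. cl (trimmed_hull r W)) ` sides \<tau>" "C' \<in> (\<lambda>W. cl (trimmed_hull r W)) ` sides \<tau>"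
    then obtain W W' where W: "W \<in> sides \<tau>" "C = cl (trimmed_hull r W)"
      and W': "W' \<in> sides \<tau>" "C' = cl (trimmed_hull r W')" by blast
    obtain W'' where W'': "W'' \<in> sides \<tau>" "W'' \<subseteq> W \<inter> W'" using sides_directed[OF \<tau> W(1) W'(1)] by blast
    then have "cl (trimmed_hull r W'') \<subseteq> C \<inter> C'"
      using sc_closure_mono[OF trimmed_hull_mono[of W'' W r], of K]
        sc_closure_mono[OF trimmed_hull_mono[of W'' W' r], of K] W(2) W'(2) by simp
    then show "\<exists>M\<in>(\<lambda>W. cl (trimmed_hull r W)) ` sides \<tau>. M \<subseteq> C \<inter> C'" using W''(1) by blast
  qed
  then obtain W where "W \<in> sides \<tau>" and WM: "cl (trimmed_hull r W) \<subseteq> M \<union> M'" by blast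
  then obtain X \<C> where X: "finite X" "X \<subseteq> V" "\<C> \<in> \<tau> X" "W = \<Union>\<C>" by (auto simp: sides_def)
  have C: "\<C> \<subseteq> comps V E X" using ultrafilters_onD(1)[OF tangles_ultrafilter[OF \<tau> X(1,2)] X(3)] .
  have side: "\<iota> ` trimmed_hull r C \<subseteq> M \<or> \<iota> ` trimmed_hull r C \<subseteq> M'" if "C \<in> \<C>" for C
  proof -
    have CX: "C \<in> comps V E X" using that C by blast
    have "C \<subseteq> V" using comps_subset[OF CX] by blast
    then have "connectedin K (trimmed_hull r C)"
      by (rule connectedin_trimmed_hull[OF star_radii _ comps_joined_within[OF CX]])
    then have conn: "connectedin B (\<iota> ` trimmed_hull r C)"
      by (rule connectedin_continuous_map_image[OF continuous_map_sc_embed])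
    have "trimmed_hull r C \<subseteq> trimmed_hull r W"
      using trimmed_hull_mono[of C W r] that X(4) by blast
    moreover have "\<iota> ` trimmed_hull r W \<subseteq> cl (trimmed_hull r W)"
      using open_hull_subset by (intro subset_sc_closure) (auto simp: trimmed_hull_def)
    ultimately have "\<iota> ` trimmed_hull r C \<subseteq> M \<union> M'" using WM by blast
    then show ?thesis
      using connectedin_subset_separated_union[OF conn] M
      by (metis separatedin_open_sets disjnt_def)
  qed
  let ?\<C> = "{C \<in> \<C>. \<iota> ` trimmed_hull r C \<subseteq> M}" and ?\<C>' = "{C \<in> \<C>. \<iota> ` trimmed_hull r C \<subseteq> M'}"
  have "\<C> = ?\<C> \<union> ?\<C>'" using side by blast
  then have "?\<C> \<in> \<tau> X \<or> ?\<C>' \<in> \<tau> X"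
    using ultrafilters_on_split[OF tangles_ultrafilter[OF \<tau> X(1,2)], of ?\<C> ?\<C>'] X(3) by simp
  moreover have miss: "tangle_continuum \<inter> N' = {}" if \<D>: "\<D> \<in> \<tau> X" and N: "\<And>C. C \<in> \<D> \<Longrightarrow> \<iota> ` trimmed_hull r C \<subseteq> N"
    and N': "openin B N'" "N' \<inter> N = {}" for \<D> N N'
  proof -
    have "\<D> \<subseteq> comps V E X" using ultrafilters_onD(1)[OF tangles_ultrafilter[OF \<tau> X(1,2)] \<D>] .
    then have "\<iota> ` trimmed_hull r (\<Union>\<D>) \<subseteq> N"
      using N unfolding trimmed_hull_Union[OF \<open>\<D> \<subseteq> comps V E X\<close>] by blast
    then have "N' \<inter> cl (trimmed_hull r (\<Union>\<D>)) = {}"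
      unfolding sc_closure_def using N' by (intro closure_of_open_disjoint) auto
    moreover have "\<Union>\<D> \<in> sides \<tau>" unfolding sides_def using X \<D> by blast
    ultimately show ?thesis unfolding tangle_continuum_def by blast
  qed
  ultimately show ?thesis
    using miss[of ?\<C> M M'] miss[of ?\<C>' M' M] M by blast
qed

lemma connectedin_tangle_continuum: "connectedin B tangle_continuum"
  unfolding connectedin_closedin
proof (intro conjI notI)
  show "tangle_continuum \<subseteq> topspace B" using closedin_subset[OF closedin_tangle_continuum] .
  assume "\<exists>A A'. closedin B A \<and> closedin B A' \<and> tangle_continuum \<subseteq> A \<union> A' \<and> A \<inter> A' \<inter> tangle_continuum = {} \<and> A \<inter> tangle_continuum \<noteq> {} \<and> A' \<inter> tangle_continuum \<noteq> {}"
  then obtain A A' where A: "closedin B A" "closedin B A'" "tangle_continuum \<subseteq> A \<union> A'" "A \<inter> A' \<inter> tangle_continuum = {}"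
    "A \<inter> tangle_continuum \<noteq> {}" "A' \<inter> tangle_continuum \<noteq> {}" by blast
  have "normal_space B"
    by (intro compact_Hausdorff_or_regular_imp_normal_space compact_space_stone_cech)
       (simp add: Hausdorff_space_stone_cech)
  moreover have "closedin B (A \<inter> tangle_continuum)" "closedin B (A' \<inter> tangle_continuum)" "disjnt (A \<inter> tangle_continuum) (A' \<inter> tangle_continuum)"
    using A closedin_tangle_continuum by (auto simp: disjnt_def)
  ultimately obtain M M' where M: "openin B M" "openin B M'" "A \<inter> tangle_continuum \<subseteq> M" "A' \<inter> tangle_continuum \<subseteq> M'" "disjnt M M'"
    unfolding normal_space_def by meson
  have "tangle_continuum \<subseteq> M \<union> M'" using A(3) M(3,4) by blast
  then show False
    using tangle_continuum_not_split[OF M(1,2)] M(3-5) A(5,6) unfolding disjnt_def by blast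
qed

end

lemma tangle_at_eq_imp_connected:
  assumes p: "p \<in> R" and q: "q \<in> R" and eq: "tangle_at p = tangle_at q"
  shows "connected_component_of (subtopology B R) p q"
proof -
  let ?ok = "\<lambda>v s. (\<forall>w. {v, w} \<in> E \<longrightarrow> 0 < s w \<and> s w < 1) \<and> p \<notin> cl (open_star E v s) \<and> q \<notin> cl (open_star E v s)"
  define r where "r = (\<lambda>v. SOME s. ?ok v s)"
  have ok: "?ok v (r v)" if "v \<in> V" for v
    unfolding r_def by (rule someI_ex[OF small_open_star[OF that p q]])
  have radii: "star_radii r"
    unfolding star_radii_def using ok edgeD(1) by blast
  let ?M = "tangle_continuum (tangle_at p) r"
  note \<tau> = tangle_at_in_tangles[OF p]
  have "connectedin (subtopology B R) ?M"
    using connectedin_tangle_continuum[OF \<tau> radii] tangle_continuum_subset_remainder[OF \<tau> radii]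
    by (simp add: connectedin_subtopology)
  moreover have "p \<in> ?M" "q \<in> ?M"
    using in_tangle_continuumI[OF \<tau> radii] ok p q eq by auto
  ultimately show ?thesis unfolding connected_component_of_def by blast
qed

lemma connected_imp_tangle_at_eq:
  assumes "connected_component_of (subtopology B R) p q"
  shows "p \<in> R" "q \<in> R" "tangle_at p = tangle_at q"
proof -
  obtain T where T: "connectedin (subtopology B R) T" "p \<in> T" "q \<in> T"
    using assms unfolding connected_component_of_def by blast
  have TR: "T \<subseteq> R" using T(1) connectedin_subset_topspace by fastforce
  then show pq: "p \<in> R" "q \<in> R" using T by auto
  have sub: "tangle_at s X \<subseteq> tangle_at t X" if st: "s \<in> T" "t \<in> T" and X: "finite X" "X \<subseteq> V" for s t X
  proof
    fix \<C> assume C: "\<C> \<in> tangle_at s X"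
    then have \<C>: "\<C> \<subseteq> comps V E X" "s \<in> cl (open_hull (\<Union>\<C>))" by (simp_all add: in_tangle_at[OF X])
    let ?S = "R \<inter> cl (open_hull (\<Union>\<C>))"
    have cld: "closedin (subtopology B R) (R \<inter> cl (open_hull (\<Union>\<D>)))" for \<D>
      using closedin_sc_closure[of K "open_hull (\<Union>\<D>)"] by (auto simp: closedin_subtopology)
    have "R - ?S = R \<inter> cl (open_hull (\<Union>(comps V E X - \<C>)))"
      using tangle_at_iff_complement[OF _ X(1) \<C>(1)] by blast
    then have "closedin (subtopology B R) (R - ?S)" using cld by simp
    moreover have "topspace (subtopology B R) = R" by (auto simp: remainder_iff)
    ultimately have "openin (subtopology B R) ?S"
      by (simp add: openin_closedin_eq)
    then have "T \<subseteq> ?S \<or> disjnt T ?S" using connectedin_clopen_cases[OF T(1) cld] by blast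
    then have "t \<in> ?S" using st \<C>(2) TR unfolding disjnt_def by blast
    then show "\<C> \<in> tangle_at t X" using \<C>(1) by (simp add: in_tangle_at[OF X])
  qed
  show "tangle_at p = tangle_at q"
    by (rule tangle_eqI[OF tangle_at_in_tangles[OF pq(1)] tangle_at_in_tangles[OF pq(2)]])
       (rule sub[OF T(2,3)])
qed

end

section \<open>The quotient map onto the tangle compactification\<close>

lemma quotient_maps_homeomorphic_space:
  assumes f: "quotient_map X Y f" and g: "quotient_map X Z g"
    and fibers: "\<And>x y. x \<in> topspace X \<Longrightarrow> y \<in> topspace X \<Longrightarrow> f x = f y \<longleftrightarrow> g x = g y"
  shows "Y homeomorphic_space Z"
proof -
  obtain h where h: "continuous_map Y Z h" "\<And>x. x \<in> topspace X \<Longrightarrow> h (f x) = g x"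
    by (rule quotient_map_lift_exists[OF f quotient_imp_continuous_map[OF g]]) (use fibers in auto)
  obtain k where k: "continuous_map Z Y k" "\<And>x. x \<in> topspace X \<Longrightarrow> k (g x) = f x"
    by (rule quotient_map_lift_exists[OF g quotient_imp_continuous_map[OF f]]) (use fibers in auto)
  have Y: "topspace Y = f ` topspace X" and Z: "topspace Z = g ` topspace X"
    using f g by (auto simp: quotient_map_def)
  have "homeomorphic_maps Y Z h k"
    unfolding homeomorphic_maps_def Y Z using h k by simp
  then show ?thesis unfolding homeomorphic_space_def by blast
qed

context graph_complex
begin

abbreviation "T \<equiv> tangle_compactification V E"

lemma topspace_tangle_compactification:
  "topspace T = Inl ` complex_points V E \<union> Inr ` tangles V E"
proof
  let ?\<G> = "{Inl ` U | U. openin K U} \<union> {tangle_nbhd V E X \<C> | X \<C>. finite X \<and> X \<subseteq> V \<and> \<C> \<subseteq> comps V E X}"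
  have T: "topspace T = \<Union>?\<G>"
    unfolding tangle_compactification_def by (rule topology_generated_by_topspace)
  have nbhd: "tangle_nbhd V E X \<C> \<subseteq> Inl ` complex_points V E \<union> Inr ` tangles V E"
    if "\<C> \<subseteq> comps V E X" for X \<C>
    unfolding tangle_nbhd_eq[OF that] by (auto simp: open_hull_def)
  show "topspace T \<subseteq> Inl ` complex_points V E \<union> Inr ` tangles V E"
    unfolding T
  proof (rule Union_least)
    fix G assume "G \<in> ?\<G>"
    then consider U where "openin K U" "G = Inl ` U" | X \<C> where "\<C> \<subseteq> comps V E X" "G = tangle_nbhd V E X \<C>"
      by blast
    then show "G \<subseteq> Inl ` complex_points V E \<union> Inr ` tangles V E"
    proof cases
      case 1
      then show ?thesis using openin_subset[OF 1(1)] topspace_complex by blast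
    next
      case 2
      then show ?thesis using nbhd by simp
    qed
  qed
  have "Inl ` complex_points V E \<in> ?\<G>"
    using openin_topspace[of K] topspace_complex by auto
  then have "Inl ` complex_points V E \<subseteq> topspace T" unfolding T by (rule Union_upper)
  moreover have "Inr ` tangles V E \<subseteq> topspace T"
  proof -
    have "tangle_nbhd V E {} (comps V E {}) \<in> ?\<G>" by blast
    then have "tangle_nbhd V E {} (comps V E {}) \<subseteq> topspace T" unfolding T by (rule Union_upper)
    moreover have "comps V E {} \<in> \<tau> {}" if "\<tau> \<in> tangles V E" for \<tau>
      using ultrafilters_onD(2)[OF tangles_ultrafilter[OF that, of "{}"]] by simp
    ultimately show ?thesis unfolding tangle_nbhd_eq[OF subset_refl] by auto
  qed
  ultimately show "Inl ` complex_points V E \<union> Inr ` tangles V E \<subseteq> topspace T" by blast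
qed

lemma openin_Inl: "openin K U \<Longrightarrow> openin T (Inl ` U)"
  unfolding tangle_compactification_def by (intro topology_generated_by_Basis) blast

lemma openin_tangle_nbhd:
  "finite X \<Longrightarrow> X \<subseteq> V \<Longrightarrow> \<C> \<subseteq> comps V E X \<Longrightarrow> openin T (tangle_nbhd V E X \<C>)"
  unfolding tangle_compactification_def by (intro topology_generated_by_Basis) blast

text \<open>
  The collapsing map described at the beginning: the identity on \<open>G\<close>, and the tangle of a point on
  the remainder.
\<close>

definition tangle_map ::
    "((('a \<Rightarrow> real) \<Rightarrow> real) \<Rightarrow> real) \<Rightarrow> ('a \<Rightarrow> real) + ('a set \<Rightarrow> 'a set set set)" where
  "tangle_map p = (if p \<in> R then Inr (tangle_at p) else Inl (inv_into (topspace K) \<iota> p))"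

lemma tangle_map_remainder: "p \<in> R \<Longrightarrow> tangle_map p = Inr (tangle_at p)"
  by (simp add: tangle_map_def)

lemma tangle_map_complex: "z \<in> topspace K \<Longrightarrow> tangle_map (\<iota> z) = Inl z"
  using inv_into_f_f[OF inj_on_sc_embed[OF completely_regular_complex t1_space_complex]]
  by (simp add: tangle_map_def remainder_iff)

lemma stone_cech_cases:
  assumes "p \<in> topspace B"
  obtains (complex) z where "z \<in> topspace K" "p = \<iota> z" | (remainder) "p \<in> R"
  using assms remainder_iff by blast

lemma tangle_map_image: "tangle_map ` topspace B = topspace T"
proof
  show "tangle_map ` topspace B \<subseteq> topspace T"
  proof (rule image_subsetI)
    fix p assume "p \<in> topspace B"
    then show "tangle_map p \<in> topspace T"
    proof (cases p rule: stone_cech_cases)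
      case (complex z)
      then show ?thesis
        using tangle_map_complex topspace_complex by (simp add: topspace_tangle_compactification)
    next
      case remainder
      then show ?thesis
        using tangle_at_in_tangles by (simp add: topspace_tangle_compactification tangle_map_remainder)
    qed
  qed
  show "topspace T \<subseteq> tangle_map ` topspace B"
  proof
    fix y assume "y \<in> topspace T"
    then consider z where "z \<in> complex_points V E" "y = Inl z" | \<tau> where "\<tau> \<in> tangles V E" "y = Inr \<tau>"
      by (auto simp: topspace_tangle_compactification)
    then show "y \<in> tangle_map ` topspace B"
    proof cases
      case 1
      then show ?thesis
        using tangle_map_complex[of z] sc_embed_in_stone_cech[of z K] topspace_complex
        by (metis image_eqI)
    next
      case 2
      then obtain p where "p \<in> R" "tangle_at p = \<tau>" using tangle_at_surj_on_vertex_limits by blast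
      then show ?thesis using 2 tangle_map_remainder remainder_iff by (metis image_eqI)
    qed
  qed
qed

text \<open>
  The preimage of a basic open set given by \<open>X\<close> and \<open>\<C>\<close> meets \<open>G\<close> in the hull of \<open>\<Union>\<C>\<close>, and the
  remainder in the complement of a closed set, by \<open>tangle_at_iff_complement\<close>. After \<open>G[X]\<close> has been
  removed, that complement has no points of \<open>G\<close> outside the hull.
\<close>

lemma continuous_tangle_map: "continuous_map (stone_cech_base_open K) T tangle_map"
proof -
  have Inl: "openin (stone_cech_base_open K) (tangle_map -` (Inl ` U) \<inter> topspace B)" if U: "openin K U" for U
  proof -
    have "tangle_map -` (Inl ` U) \<inter> topspace B = \<iota> ` U"
    proof (intro set_eqI iffI)
      fix p assume p: "p \<in> tangle_map -` (Inl ` U) \<inter> topspace B"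
      then have "p \<in> topspace B" by simp
      then show "p \<in> \<iota> ` U"
      proof (cases p rule: stone_cech_cases)
        case (complex z)
        then show ?thesis using p tangle_map_complex by auto
      next
        case remainder
        then show ?thesis using p tangle_map_remainder by auto
      qed
    next
      fix p assume "p \<in> \<iota> ` U"
      then obtain z where z: "z \<in> U" "p = \<iota> z" by blast
      then have "z \<in> topspace K" using openin_subset[OF U] by blast
      then show "p \<in> tangle_map -` (Inl ` U) \<inter> topspace B"
        using z tangle_map_complex sc_embed_in_stone_cech by simp
    qed
    moreover have "openin (stone_cech_base_open K) (\<iota> ` U)"
      unfolding openin_stone_cech_base_open[OF completely_regular_complex]
    proof (intro conjI)
      show "\<iota> ` U \<subseteq> topspace B"
        by (rule order_trans[OF subset_sc_closure[OF openin_subset[OF U]] sc_closure_subset])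
      have "{z \<in> topspace K. \<iota> z \<in> \<iota> ` U} = U"
        using inj_on_sc_embed[OF completely_regular_complex t1_space_complex] openin_subset[OF U]
        by (auto simp: inj_on_def)
      then show "openin K {z \<in> topspace K. \<iota> z \<in> \<iota> ` U}" using U by simp
      show "\<exists>N. openin B N \<and> N \<subseteq> \<iota> ` U \<and> \<iota> ` U - \<iota> ` topspace K \<subseteq> N"
        using openin_subset[OF U] by (intro exI[of _ "{}"]) auto
    qed
    ultimately show ?thesis by simp
  qed
  have nbhd: "openin (stone_cech_base_open K) (tangle_map -` tangle_nbhd V E X \<C> \<inter> topspace B)"
    if X: "finite X" "X \<subseteq> V" and C: "\<C> \<subseteq> comps V E X" for X \<C>
  proof -
    let ?P = "tangle_map -` tangle_nbhd V E X \<C> \<inter> topspace B"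
    let ?\<D> = "comps V E X - \<C>"
    let ?N = "topspace B - (cl (open_hull (\<Union>?\<D>)) \<union> cl (full_subcomplex X))"
    have P_complex: "\<iota> z \<in> ?P \<longleftrightarrow> z \<in> open_hull (\<Union>\<C>)" if "z \<in> topspace K" for z
      using that tangle_map_complex[OF that] sc_embed_in_stone_cech[OF that]
      by (auto simp: tangle_nbhd_eq[OF C])
    have P_remainder: "p \<in> ?P \<longleftrightarrow> p \<notin> cl (open_hull (\<Union>?\<D>))" if p: "p \<in> R" for p
    proof -
      have "p \<in> ?P \<longleftrightarrow> \<C> \<in> tangle_at p X"
        using p tangle_at_in_tangles[OF p] by (auto simp: tangle_nbhd_eq[OF C] tangle_map_remainder remainder_iff)
      then show ?thesis
        using tangle_at_iff_complement[OF p X(1) C] C by (simp add: in_tangle_at[OF X])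
    qed
    show ?thesis
      unfolding openin_stone_cech_base_open[OF completely_regular_complex]
    proof (intro conjI)
      have "{z \<in> topspace K. \<iota> z \<in> ?P} = open_hull (\<Union>\<C>)"
        using P_complex open_hull_subset by blast
      then show "openin K {z \<in> topspace K. \<iota> z \<in> ?P}" using openin_open_hull by simp
      have "openin B ?N"
        by (intro openin_diff openin_topspace closedin_Un closedin_sc_closure)
      moreover have "?N \<subseteq> ?P"
      proof
        fix p assume p: "p \<in> ?N"
        then have "p \<in> topspace B" by simp
        then show "p \<in> ?P"
        proof (cases p rule: stone_cech_cases)
          case (complex z)
          have "\<Union>\<C> \<union> \<Union>?\<D> = V - X"
            using C by (simp flip: Union_Un_distrib add: Un_absorb1 Union_comps)
          then have "topspace K = open_hull (\<Union>\<C> \<union> \<Union>?\<D>) \<union> full_subcomplex X"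
            by (intro complex_eq_Un) auto
          moreover have "z \<notin> open_hull (\<Union>?\<D>)"
            using p complex(2) subset_sc_closure[OF open_hull_subset] by blast
          moreover have "z \<notin> full_subcomplex X"
            using p complex(2) sc_closure_compact[OF compactin_full_subcomplex[OF X(1)]] by blast
          ultimately have "z \<in> open_hull (\<Union>\<C>)" using complex(1) by (simp add: open_hull_Un)
          then show ?thesis using P_complex[OF complex(1)] complex(2) by simp
        next
          case remainder
          then show ?thesis using P_remainder p by blast
        qed
      qed
      moreover have "?P - \<iota> ` topspace K \<subseteq> ?N"
      proof
        fix p assume p: "p \<in> ?P - \<iota> ` topspace K"
        then have pR: "p \<in> R" by (simp add: remainder_iff)
        then have "p \<notin> cl (open_hull (\<Union>?\<D>))" using P_remainder p by blast
        moreover have "p \<notin> cl (full_subcomplex X)"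
          using p sc_closure_compact[OF compactin_full_subcomplex[OF X(1)]]
            compactin_subset_topspace[OF compactin_full_subcomplex[OF X(1)]] by blast
        ultimately show "p \<in> ?N" using p by blast
      qed
      ultimately show "\<exists>N. openin B N \<and> N \<subseteq> ?P \<and> ?P - \<iota> ` topspace K \<subseteq> N" by blast
    qed blast
  qed
  show ?thesis
    unfolding tangle_compactification_def
  proof (rule continuous_on_generated_topo)
    fix U assume "U \<in> {Inl ` U | U. openin K U} \<union>
      {tangle_nbhd V E X \<C> | X \<C>. finite X \<and> X \<subseteq> V \<and> \<C> \<subseteq> comps V E X}"
    then show "openin (stone_cech_base_open K) (tangle_map -` U \<inter> topspace (stone_cech_base_open K))"
      unfolding topspace_stone_cech_base_open using Inl nbhd by blast
  next
    show "tangle_map ` topspace (stone_cech_base_open K) \<subseteq> \<Union>({Inl ` U | U. openin K U} \<union>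
      {tangle_nbhd V E X \<C> | X \<C>. finite X \<and> X \<subseteq> V \<and> \<C> \<subseteq> comps V E X})"
      using tangle_map_image
      unfolding topspace_stone_cech_base_open tangle_compactification_def topology_generated_by_topspace
      by simp
  qed
qed

text \<open>
  Let the preimage of \<open>S\<close> be open and let \<open>U\<close> be an open set of the Stone-Cech compactification inside
  it that contains its part in the remainder. Around a tangle in \<open>S\<close>, one side has its hull inside
  \<open>U\<close>, which puts the points of \<open>G\<close> in that hull into \<open>S\<close>; for another side, \<open>U\<close> meets the fibres of
  all tangles living on it, which puts these tangles into \<open>S\<close>. A common smaller side provides the neighbourhood.
\<close>

lemma quotient_map_tangle_map: "quotient_map (stone_cech_base_open K) T tangle_map"
  unfolding quotient_map_def topspace_stone_cech_base_open
proof (intro conjI allI impI iffI)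
  show "tangle_map ` topspace B = topspace T" by (rule tangle_map_image)
next
  fix S assume "openin T S"
  then show "openin (stone_cech_base_open K) {p \<in> topspace B. tangle_map p \<in> S}"
    using openin_continuous_map_preimage[OF continuous_tangle_map] by (simp add: topspace_stone_cech_base_open)
next
  fix S assume S: "S \<subseteq> topspace T" and pre: "openin (stone_cech_base_open K) {p \<in> topspace B. tangle_map p \<in> S}"
  let ?P = "{p \<in> topspace B. tangle_map p \<in> S}"
  obtain U where U: "openin B U" "U \<subseteq> ?P" "?P - \<iota> ` topspace K \<subseteq> U"
    using openin_stone_cech_base_open_imp[OF pre] by blast
  have trace: "{z \<in> topspace K. \<iota> z \<in> ?P} = {z \<in> topspace K. Inl z \<in> S}"
    using tangle_map_complex sc_embed_in_stone_cech[of _ K] by fastforce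
  have open_trace: "openin K {z \<in> topspace K. Inl z \<in> S}"
    using openin_stone_cech_base_open_imp[OF pre] unfolding trace by blast
  show "openin T S"
  proof (subst openin_subopen, intro ballI)
    fix y assume y: "y \<in> S"
    then have "y \<in> topspace T" using S by blast
    then consider z where "z \<in> complex_points V E" "y = Inl z" | \<tau> where "\<tau> \<in> tangles V E" "y = Inr \<tau>"
      by (auto simp: topspace_tangle_compactification)
    then show "\<exists>N. openin T N \<and> y \<in> N \<and> N \<subseteq> S"
    proof cases
      case 1
      have "openin T (Inl ` {z \<in> topspace K. Inl z \<in> S})" by (rule openin_Inl[OF open_trace])
      moreover have "y \<in> Inl ` {z \<in> topspace K. Inl z \<in> S}" using 1 y by (simp add: topspace_complex)
      ultimately show ?thesis by blast
    next
      case 2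
      have fiber: "p \<in> U" if "p \<in> R" "tangle_at p = \<tau>" for p
        using that U(3) y 2(2) by (auto simp: remainder_iff tangle_map_remainder)
      obtain W where W: "W \<in> sides \<tau>" "\<iota> ` open_hull W \<subseteq> U"
        using open_contains_hull[OF U(1) 2(1) fiber] by blast
      obtain W' where W': "W' \<in> sides \<tau>" "R \<inter> cl (vertex_point ` V \<inter> open_hull W') \<subseteq> U"
        using open_contains_vertex_limits[OF U(1) 2(1) fiber] by blast
      obtain W'' where "W'' \<in> sides \<tau>" and sub: "W'' \<subseteq> W" "W'' \<subseteq> W'" using sides_directed[OF 2(1) W(1) W'(1)] by blast
      then obtain X \<C> where X: "finite X" "X \<subseteq> V" "\<C> \<in> \<tau> X" and W'': "W'' = \<Union>\<C>"
        by (auto simp: sides_def)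
      have C: "\<C> \<subseteq> comps V E X" using ultrafilters_onD(1)[OF tangles_ultrafilter[OF 2(1) X(1,2)] X(3)] .
      have "Inl z \<in> S" if z: "z \<in> open_hull (\<Union>\<C>)" for z
      proof -
        have zK: "z \<in> topspace K" using z open_hull_subset by blast
        have "\<iota> z \<in> U" using z W(2) open_hull_mono[OF sub(1)] unfolding W'' by blast
        then have "tangle_map (\<iota> z) \<in> S" using U(2) by blast
        then show ?thesis using tangle_map_complex[OF zK] by simp
      qed
      moreover have "Inr \<sigma> \<in> S" if \<sigma>: "\<sigma> \<in> tangles V E" "\<C> \<in> \<sigma> X" for \<sigma>
      proof -
        obtain p where p: "p \<in> R" "p \<in> cl (vertex_point ` V)" "tangle_at p = \<sigma>"
          using tangle_at_surj_on_vertex_limits[OF \<sigma>(1)] by blast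
        have "p \<in> cl (vertex_point ` V \<inter> open_hull W'')"
          unfolding W'' using in_cl_Int_open_hull[OF p(1,2) vertex_points_discrete(1) X(1,2)] p(3) \<sigma>(2) by simp
        moreover have "vertex_point ` V \<inter> open_hull W'' \<subseteq> vertex_point ` V \<inter> open_hull W'"
          using open_hull_mono[OF sub(2)] by blast
        ultimately have "p \<in> cl (vertex_point ` V \<inter> open_hull W')"
          using subsetD[OF sc_closure_mono] by metis
        then have "p \<in> U" using W'(2) p(1) by blast
        then have "tangle_map p \<in> S" using U(2) by blast
        then show ?thesis using p by (simp add: tangle_map_remainder)
      qed
      ultimately have "tangle_nbhd V E X \<C> \<subseteq> S" unfolding tangle_nbhd_eq[OF C] by blast
      moreover have "y \<in> tangle_nbhd V E X \<C>" unfolding tangle_nbhd_eq[OF C] using 2 X(3) by blast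
      ultimately show ?thesis using openin_tangle_nbhd[OF X(1,2) C] by blast
    qed
  qed
qed

lemma tangle_map_eq_iff:
  assumes p: "p \<in> topspace B" and q: "q \<in> topspace B"
  shows "tangle_map p = tangle_map q \<longleftrightarrow> (p, q) \<in> remainder_equiv K"
proof -
  have "tangle_map p = tangle_map q \<longleftrightarrow> p = q \<or> connected_component_of (subtopology B R) p q"
  proof
    assume eq: "tangle_map p = tangle_map q"
    show "p = q \<or> connected_component_of (subtopology B R) p q"
      using p
    proof (cases p rule: stone_cech_cases)
      case (complex z)
      from q show ?thesis
      proof (cases q rule: stone_cech_cases)
        case (complex z')
        then show ?thesis using eq \<open>z \<in> topspace K\<close> \<open>p = \<iota> z\<close> tangle_map_complex by simp
      next
        case remainder
        then show ?thesis using eq \<open>z \<in> topspace K\<close> \<open>p = \<iota> z\<close> tangle_map_complex tangle_map_remainder by simp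
      qed
    next
      case remainder
      from q show ?thesis
      proof (cases q rule: stone_cech_cases)
        case (complex z')
        then show ?thesis using eq \<open>p \<in> R\<close> tangle_map_complex tangle_map_remainder by simp
      next
        case remainder
        then show ?thesis
          using eq \<open>p \<in> R\<close> tangle_at_eq_imp_connected by (simp add: tangle_map_remainder)
      qed
    qed
  next
    assume "p = q \<or> connected_component_of (subtopology B R) p q"
    then show "tangle_map p = tangle_map q"
      using connected_imp_tangle_at_eq[of p q] tangle_map_remainder by auto
  qed
  then show ?thesis using p q by (simp add: remainder_equiv_def)
qed

lemma equiv_remainder_equiv: "equiv (topspace B) (remainder_equiv K)"
proof (rule equivI)
  show "remainder_equiv K \<subseteq> topspace B \<times> topspace B" by (auto simp: remainder_equiv_def)
  show "refl_on (topspace B) (remainder_equiv K)" by (auto simp: refl_on_def remainder_equiv_def)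
  show "sym (remainder_equiv K)" by (auto simp: sym_def remainder_equiv_def connected_component_of_sym)
  show "trans (remainder_equiv K)"
    unfolding trans_def remainder_equiv_def using connected_component_of_trans by fastforce
qed

end

theorem theorem1:
  fixes V :: "'a set" and E :: "'a set set"
  assumes "simple_graph V E" and "connected_graph V E" and "infinite V"
  shows "tangle_compactification V E homeomorphic_space
    quotient_space (stone_cech_base_open (one_complex V E)) (remainder_equiv (one_complex V E))"
proof -
  interpret graph_complex V E by (rule graph_complex.intro[OF assms(1)])
  show ?thesis
  proof (rule quotient_maps_homeomorphic_space[OF quotient_map_tangle_map quotient_map_quotient_space])
    fix p q
    assume "p \<in> topspace (stone_cech_base_open K)" "q \<in> topspace (stone_cech_base_open K)"
    then have pq: "p \<in> topspace B" "q \<in> topspace B" by (simp_all add: topspace_stone_cech_base_open)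
    show "tangle_map p = tangle_map q \<longleftrightarrow> remainder_equiv K `` {p} = remainder_equiv K `` {q}"
      unfolding tangle_map_eq_iff[OF pq] using eq_equiv_class_iff[OF equiv_remainder_equiv pq] by simp
  qed
qed

end
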